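(* Let $(W_1,S_1,\mu_1)$ and $(W_2,S_2,\mu_2)$ be graphons where $(S_i,\mathcal F_i,\mu_i)$ are $\sigma$-finite Borel measure spaces, $i=1,2$. Then there exist trivial extensions $(\tilde W_i,\tilde S_i,\tilde\mu_i)$ of $(W_i,S_i,\mu_i)$ with $\tilde\mu_1(\tilde S_1)=\tilde\mu_2(\tilde S_2)$ and a coupling $(\varphi_1,\varphi_2)$ of $\tilde S_1$ and $\tilde S_2$ such that \[ \delta_\square(W_1,W_2)=\delta_\square(\tilde W_1,\tilde W_2)=\|\tilde W_1^{\varphi_1}-\tilde W_2^{\varphi_2}\|_\square . \] Moreover, the coupling may be taken to be special.
   Context: A graphon $(W,S,\mathcal F,\mu)$ is a symmetric real-valued function $W\in L^1(S\times S,\mu\times\mu)$ (not necessarily bounded or nonnegative), where $(S,\mathcal F,\mu)$ is a $\sigma$-finite measure space; graphons equal a.e. are identified. The cut norm of $F\in L^1(S\times S)$ is $\|F\|_\square:=\sup_{T,U}|\int_{T\times U}F\,d\mu\,d\mu|$ over measurable $T,U\subseteq S$. For $\varphi:S_1\to S_2$ and $W$ on $S_2\times S_2$, the pull-back is $W^{\varphi}(x,y):=W(\varphi(x),\varphi(y))$. A map $\varphi:(S_1,\mu_1)\to(S_2,\mu_2)$ is measure-preserving if it is measurable and $\mu_1(\varphi^{-1}(A))=\mu_2(A)$ for all measurable $A$. A coupling of $(S_1,\mu_1)$ and $(S_2,\mu_2)$ is a pair of measure-preserving maps $\varphi_i:S\to S_i$ defined on a common $\sigma$-finite measure space $(S,\mu)$;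 it is special if $S=S_1\times S_2$ and $\varphi_i$ are the coordinate projections. A trivial extension of a graphon $(W,S,\mu)$ is a graphon $(\tilde W,\tilde S,\tilde\mu)$ such that $S$ is a measurable subset of $\tilde S$ with $\tilde\mu$ restricted to subsets of $S$ equal to $\mu$, and $\tilde W=W$ on $S\times S$ and $\tilde W=0$ elsewhere. Cut distance: if $\mu_1(S_1)=\mu_2(S_2)$, $\delta_\square(W_1,W_2):=\inf_{(\varphi_1,\varphi_2)}\|W_1^{\varphi_1}-W_2^{\varphi_2}\|_\square$ over all couplings; in general $\delta_\square(W_1,W_2):=\delta_\square(\tilde W_1,\tilde W_2)$ for any trivial extensions with $\tilde\mu_1(\tilde S_1)=\tilde\mu_2(\tilde S_2)$ (this is well defined and a pseudometric). A measure space is Borel if its underlying measurable space is isomorphic to a Borel subset of a Polish space with its Borel $\sigma$-algebra. *)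

theory Defs
  imports "HOL-Analysis.Analysis"
begin

definition graphon :: "'a measure \<Rightarrow> ('a \<Rightarrow> 'a \<Rightarrow> real) \<Rightarrow> bool" where
  "graphon M W \<longleftrightarrow> sigma_finite_measure M
     \<and> integrable (M \<Otimes>\<^sub>M M) (\<lambda>z. W (fst z) (snd z))
     \<and> (\<forall>x\<in>space M. \<forall>y\<in>space M. W x y = W y x)"

definition cut_norm :: "'a measure \<Rightarrow> ('a \<Rightarrow> 'a \<Rightarrow> real) \<Rightarrow> real" where
  "cut_norm M F = (SUP TU \<in> sets M \<times> sets M.
      \<bar>set_lebesgue_integral (M \<Otimes>\<^sub>M M) (fst TU \<times> snd TU) (\<lambda>z. F (fst z) (snd z))\<bar>)"

definition pullback :: "('c \<Rightarrow> 'a) \<Rightarrow> ('a \<Rightarrow> 'a \<Rightarrow> real) \<Rightarrow> 'c \<Rightarrow> 'c \<Rightarrow> real" where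
  "pullback \<phi> W = (\<lambda>x y. W (\<phi> x) (\<phi> y))"

definition measure_preserving :: "'c measure \<Rightarrow> 'a measure \<Rightarrow> ('c \<Rightarrow> 'a) \<Rightarrow> bool" where
  "measure_preserving N M \<phi> \<longleftrightarrow> \<phi> \<in> measurable N M
     \<and> (\<forall>A\<in>sets M. emeasure N (\<phi> -` A \<inter> space N) = emeasure M A)"

definition coupling :: "'c measure \<Rightarrow> 'a measure \<Rightarrow> 'b measure \<Rightarrow> ('c \<Rightarrow> 'a) \<Rightarrow> ('c \<Rightarrow> 'b) \<Rightarrow> bool" where
  "coupling N M1 M2 \<phi>1 \<phi>2 \<longleftrightarrow> sigma_finite_measure N
     \<and> measure_preserving N M1 \<phi>1 \<and> measure_preserving N M2 \<phi>2"

definition special_coupling :: "('a \<times> 'b) measure \<Rightarrow> 'a measure \<Rightarrow> 'b measure \<Rightarrow> bool" where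
  "special_coupling N M1 M2 \<longleftrightarrow> sets N = sets (M1 \<Otimes>\<^sub>M M2) \<and> coupling N M1 M2 fst snd"

text \<open>Trivial extension (W',M') of (W,M), where S is identified with its image under the
  embedding \<iota>, which is an isomorphism of S onto a measurable subset of S' with the
  restricted sigma-algebra and measure; W' = W on the copy of S x S and 0 elsewhere.\<close>
definition trivial_extension ::
  "'a measure \<Rightarrow> ('a \<Rightarrow> 'a \<Rightarrow> real) \<Rightarrow> ('a \<Rightarrow> 'c) \<Rightarrow> 'c measure \<Rightarrow> ('c \<Rightarrow> 'c \<Rightarrow> real) \<Rightarrow> bool" where
  "trivial_extension M W \<iota> M' W' \<longleftrightarrow> graphon M' W'
     \<and> inj_on \<iota> (space M) \<and> \<iota> \<in> measurable M M' \<and> \<iota> ` space M \<in> sets M'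
     \<and> (\<forall>A\<in>sets M. \<iota> ` A \<in> sets M' \<and> emeasure M' (\<iota> ` A) = emeasure M A)
     \<and> (\<forall>x\<in>space M. \<forall>y\<in>space M. W' (\<iota> x) (\<iota> y) = W x y)
     \<and> (\<forall>x\<in>space M'. \<forall>y\<in>space M'.
          \<not> (x \<in> \<iota> ` space M \<and> y \<in> \<iota> ` space M) \<longrightarrow> W' x y = 0)"

text \<open>Cut distance, with the types of the trivial extensions ('c, 'd) and of the coupling
  space ('e) as explicit parameters (HOL cannot quantify over types inside a term).
  The infimum over all types is expressed in the theorem via free type variables.\<close>
definition cut_dist ::
  "'c itself \<Rightarrow> 'd itself \<Rightarrow> 'e itself \<Rightarrow>
   'a measure \<Rightarrow> ('a \<Rightarrow> 'a \<Rightarrow> real) \<Rightarrow> 'b measure \<Rightarrow> ('b \<Rightarrow> 'b \<Rightarrow> real) \<Rightarrow> ereal" where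
  "cut_dist _ _ _ M1 W1 M2 W2 =
     (INF v \<in> {ereal (cut_norm N (\<lambda>x y. pullback \<phi>1 W1' x y - pullback \<phi>2 W2' x y)) | 
                 (M1' :: 'c measure) W1' \<iota>1 (M2' :: 'd measure) W2' \<iota>2 (N :: 'e measure) \<phi>1 \<phi>2.
                 trivial_extension M1 W1 \<iota>1 M1' W1' \<and> trivial_extension M2 W2 \<iota>2 M2' W2'
                 \<and> emeasure M1' (space M1') = emeasure M2' (space M2')
                 \<and> coupling N M1' M2' \<phi>1 \<phi>2}. v)"

definition borel_msp :: "'p::polish_space itself \<Rightarrow> 'a measure \<Rightarrow> bool" where
  "borel_msp _ M \<longleftrightarrow> (\<exists>(B :: 'p set) f g. B \<in> sets borel
      \<and> f \<in> measurable M (restrict_space borel B)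
      \<and> g \<in> measurable (restrict_space borel B) M
      \<and> (\<forall>x\<in>space M. f x \<in> B \<and> g (f x) = x) \<and> (\<forall>y\<in>B. g y \<in> space M \<and> f (g y) = y))"

end

theory Submission
  imports Defs
begin

text \<open>The proof is a compactness argument on Cantor space. A \<open>\<sigma>\<close>-finite Borel space is coded by
  0-1 sequences, each coordinate being a set of finite measure, and the zero sequence is reserved
  for all points that a trivial extension adds. Every coupling of trivial extensions then becomes a
  measure on pairs of codes whose marginals off the zero sequence are prescribed. Such measures are
  uniformly bounded on clopen sets that avoid the zero pair, so that a subsequence of a minimizing
  sequence converges on these sets; by compactness the limit is a measure. The prescribed marginals
  dominate all the measures that enter the cut norm, hence integrals of the (merely integrable)
  kernels over clopen rectangles converge as well. As clopen rectangles suffice to compute the cut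
  norm, it is lower semicontinuous and the limit is optimal. Decoding turns the optimal measure into
  a special coupling of trivial extensions.\<close>

section \<open>Compact zero-dimensional spaces\<close>

text \<open>In a minimizing sequence mass can escape to infinity in one space while it stays in a
  set of finite measure in the other. On codes it is not lost: it ends on pairs with exactly one
  coordinate \<open>nocode\<close>, which decode to points matched with new points. This is where
  the trivial extensions of the conclusion come from. Mass near the zero pair has no bound at all,
  but neither kernel sees that pair, so it is cut away throughout. The topology on codes is
  auxiliary: the kernels are merely measurable for it and may be unbounded, so weak convergence of
  couplings alone says nothing about their integrals. What helps is that \<open>W1\<close> depends
  only on first coordinates and \<open>W2\<close> only on second ones. Restrict a coupling to a test
  set and project it to one factor: the result stays below a marginal that is the same for all
  couplings. The two kernels are therefore treated separately, each against its own marginal, and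
  are put together again only inside the absolute value of a single test integral.\<close>

class compact_zero_dim = second_countable_topology +
  assumes compact_univ: "compact (UNIV :: 'a set)"
    and clopen_nbhd: "open U \<Longrightarrow> x \<in> U \<Longrightarrow> \<exists>C. open C \<and> closed C \<and> x \<in> C \<and> C \<subseteq> U"

definition clopen :: "'a::topological_space set \<Rightarrow> bool" where
  "clopen C \<longleftrightarrow> open C \<and> closed C"

lemma clopen_simps [simp, intro]:
  "clopen {}" "clopen UNIV"
  "clopen A \<Longrightarrow> clopen B \<Longrightarrow> clopen (A \<union> B)"
  "clopen A \<Longrightarrow> clopen B \<Longrightarrow> clopen (A \<inter> B)"
  "clopen A \<Longrightarrow> clopen B \<Longrightarrow> clopen (A - B)"
  "clopen A \<Longrightarrow> clopen (- A)"
  by (auto simp: clopen_def)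

lemma clopen_vimage: "continuous_on UNIV f \<Longrightarrow> clopen C \<Longrightarrow> clopen (f -` C)"
  by (auto simp: clopen_def closed_vimage open_vimage)

text \<open>The instances for \<open>bool\<close>, products and functions on a countable type make
  the class available for codes and for pairs of codes alike, so each limit theorem is proved once
  and used on both.\<close>

instance bool :: compact_zero_dim
proof
  have "generate_topology UNIV = (open :: bool set \<Rightarrow> bool)"
    by (auto simp: fun_eq_iff open_discrete intro: generate_topology.Basis)
  then show "\<exists>B :: bool set set. countable B \<and> open = generate_topology B"
    by (intro exI[of _ UNIV]) auto
  show "compact (UNIV :: bool set)" by (simp add: finite_imp_compact)
  fix U :: "bool set" and x assume "open U" "x \<in> U"
  then show "\<exists>C. open C \<and> closed C \<and> x \<in> C \<and> C \<subseteq> U"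
    by (intro exI[of _ "{x}"]) (auto simp: open_discrete)
qed

instance prod :: (compact_zero_dim, compact_zero_dim) compact_zero_dim
proof
  show "compact (UNIV :: ('a \<times> 'b) set)"
    using compact_Times[OF compact_univ compact_univ] by simp
  fix U :: "('a \<times> 'b) set" and x assume "open U" "x \<in> U"
  then obtain A B where AB: "open A" "open B" "fst x \<in> A" "snd x \<in> B" "A \<times> B \<subseteq> U"
    by (metis open_prod_elim mem_Times_iff)
  obtain C D where "open C \<and> closed C \<and> fst x \<in> C \<and> C \<subseteq> A" "open D \<and> closed D \<and> snd x \<in> D \<and> D \<subseteq> B"
    using clopen_nbhd AB by metis
  then show "\<exists>C. open C \<and> closed C \<and> x \<in> C \<and> C \<subseteq> U"
    using AB by (intro exI[of _ "C \<times> D"]) (auto simp: open_Times closed_Times mem_Times_iff)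
qed

instance "fun" :: (countable, compact_zero_dim) compact_zero_dim
proof
  have "compact_space (product_topology (\<lambda>i::'a. euclidean :: 'b topology) UNIV)"
    by (rule compact_space_product_topology[THEN iffD2])
       (use compact_univ in \<open>auto simp: compact_space_def\<close>)
  then show "compact (UNIV :: ('a \<Rightarrow> 'b) set)"
    by (simp add: compact_space_def euclidean_product_topology)
  fix U :: "('a \<Rightarrow> 'b) set" and x assume U: "open U" "x \<in> U"
  obtain X where X: "x \<in> Pi\<^sub>E UNIV X" "\<And>i. open (X i)" "finite {i. X i \<noteq> UNIV}" "Pi\<^sub>E UNIV X \<subseteq> U"
    using product_topology_open_contains_basis[OF U(1)[unfolded open_fun_def] U(2)] by auto
  \<comment> \<open>A factor that is unrestricted in \<open>X\<close> stays unrestricted in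
    \<open>C\<close>; otherwise infinitely many factors could be proper and the product of the
    \<open>C i\<close> need not be open.\<close>
  have "\<exists>C. open C \<and> closed C \<and> x i \<in> C \<and> C \<subseteq> X i \<and> (X i = UNIV \<longrightarrow> C = UNIV)" for i
    using clopen_nbhd[of "X i" "x i"] X by (cases "X i = UNIV") auto
  then obtain C where C: "\<And>i. open (C i)" "\<And>i. closed (C i)" "\<And>i. x i \<in> C i"
    "\<And>i. C i \<subseteq> X i" "\<And>i. X i = UNIV \<Longrightarrow> C i = UNIV" by metis
  have "open (Pi\<^sub>E UNIV C)"
    by (rule open_PiE) (use C X(3) in \<open>auto intro: finite_subset[of _ "{i. X i \<noteq> UNIV}"]\<close>)
  moreover have "Pi\<^sub>E UNIV C = (\<Inter>i. (\<lambda>f. f i) -` C i)" by (auto simp: PiE_def Pi_def)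
  then have "closed (Pi\<^sub>E UNIV C)"
    using C by (auto intro!: closed_INT closed_vimage)
  moreover have "x \<in> Pi\<^sub>E UNIV C" "Pi\<^sub>E UNIV C \<subseteq> U"
    using C X by (auto simp: PiE_def Pi_def subset_iff)
  ultimately show "\<exists>C. open C \<and> closed C \<and> x \<in> C \<and> C \<subseteq> U" by blast
qed

text \<open>A clopen set is compact and open, hence a finite union of members of a countable basis.
  Countability is used twice: every open set becomes a countable union of clopen sets, and a
  subsequence can be chosen that converges on all clopen sets at once.\<close>

lemma countable_clopen: "countable {C :: 'a::compact_zero_dim set. clopen C}"
proof -
  obtain B :: "'a set set" where B: "countable B" "topological_basis B"
    using ex_countable_basis by blast
  have "{C. clopen C} \<subseteq> Union ` {A. finite A \<and> A \<subseteq> B}"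
  proof
    fix C :: "'a set" assume "C \<in> {C. clopen C}"
    then have "open C" "compact C"
      using compact_Int_closed[OF compact_univ, of C] by (auto simp: clopen_def)
    obtain B' where "B' \<subseteq> B" "\<Union>B' = C" using B \<open>open C\<close> by (auto simp: topological_basis_def)
    moreover from this obtain A where "finite A" "A \<subseteq> B'" "C \<subseteq> \<Union>A"
      by (metis \<open>compact C\<close> B(2) compactE order.refl subsetD topological_basis_open)
    ultimately show "C \<in> Union ` {A. finite A \<and> A \<subseteq> B}" by (intro image_eqI[of _ _ A]) auto
  qed
  then show ?thesis
    by (rule countable_subset) (intro countable_image countable_Collect_finite_subset B)
qed

lemma open_eq_Union_clopen:
  fixes U :: "'a::compact_zero_dim set"
  assumes "open U" shows "U = \<Union>{C. clopen C \<and> C \<subseteq> U}"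
  using clopen_nbhd[OF assms] by (auto simp: clopen_def)

lemma borel_eq_sigma_clopen:
  "sets (borel :: 'a::compact_zero_dim measure) = sigma_sets UNIV {C. clopen C}"
proof -
  have "U \<in> sigma_sets UNIV {C. clopen C}" if "open U" for U :: "'a set"
  proof (subst open_eq_Union_clopen[OF that], rule sigma_sets_UNION)
    show "countable {C. clopen C \<and> C \<subseteq> U}"
      using countable_clopen by (rule countable_subset[rotated]) auto
  qed auto
  moreover have "sets (borel :: 'a measure) = sigma_sets UNIV {U. open U}"
    by (simp add: borel_def)
  ultimately show ?thesis
    by (auto intro!: equalityI sigma_sets_mono simp: clopen_def)
qed

section \<open>Limits of measures\<close>

text \<open>The diagonal argument in the form of Tychonoff's theorem: a product of countably many
  compact intervals is compact in the function space, hence sequentially compact, and convergence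
  there is convergence at each \<open>n\<close>.\<close>

lemma pointwise_convergent_subsequence:
  fixes g :: "nat \<Rightarrow> nat \<Rightarrow> real"
  assumes "\<And>k n. a n \<le> g k n" "\<And>k n. g k n \<le> b n"
  obtains r l where "strict_mono r" "\<And>n. (\<lambda>k. g (r k) n) \<longlonglongrightarrow> l n"
proof -
  have "compactin (product_topology (\<lambda>i. euclidean) UNIV) (Pi\<^sub>E UNIV (\<lambda>n. {a n..b n}))"
    by (subst compactin_PiE) auto
  then have "compact (Pi\<^sub>E UNIV (\<lambda>n. {a n..b n}))"
    by (simp add: euclidean_product_topology)
  then have "seq_compact (Pi\<^sub>E UNIV (\<lambda>n. {a n..b n}))"
    by (rule compact_imp_seq_compact)
  moreover have "\<forall>k. g k \<in> Pi\<^sub>E UNIV (\<lambda>n. {a n..b n})" using assms by auto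
  ultimately obtain l r where r: "strict_mono r" "(g \<circ> r) \<longlonglongrightarrow> l"
    unfolding seq_compact_def by metis
  have "(\<lambda>k. (g \<circ> r) k n) \<longlonglongrightarrow> l n" for n
    by (rule continuous_on_tendsto_compose[OF continuous_on_product_coordinates r(2)]) auto
  then show ?thesis using that r(1) by auto
qed

text \<open>Clopen sets that avoid \<open>z\<close> form a ring without a largest element. They
  still generate everything: \<open>- {z}\<close> is a countable union of them, so
  \<open>{z}\<close> is obtained as a complement.\<close>

lemma borel_eq_sigma_clopen_off:
  fixes z :: "'x::compact_zero_dim"
  assumes z: "open (- {z})"
  shows "sets (borel :: 'x measure) = sigma_sets UNIV {C. clopen C \<and> z \<notin> C}"
proof -
  define R where "R = {C. clopen C \<and> z \<notin> C}"
  have off: "U \<in> sigma_sets UNIV R" if "open U" "z \<notin> U" for U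
  proof -
    have "U = \<Union>{C. clopen C \<and> C \<subseteq> U}" using that open_eq_Union_clopen by blast
    moreover have "\<Union>{C. clopen C \<and> C \<subseteq> U} \<in> sigma_sets UNIV R"
      using that
      by (intro sigma_sets_UNION countable_subset[OF _ countable_clopen]) (auto simp: R_def)
    ultimately show ?thesis by simp
  qed
  have zR: "{z} \<in> sigma_sets UNIV R"
    using sigma_sets.Compl[OF off[OF z]] by (simp add: Compl_eq_Diff_UNIV[symmetric])
  have "U \<in> sigma_sets UNIV R" if U: "open U" for U
  proof (cases "z \<in> U")
    case True
    have "U - {z} \<in> sigma_sets UNIV R"
      by (rule off) (use U z in \<open>auto simp: Diff_eq\<close>)
    then have "{z} \<union> (U - {z}) \<in> sigma_sets UNIV R"
      using zR by (intro sigma_sets_Un)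
    moreover have "{z} \<union> (U - {z}) = U" using True by auto
    ultimately show ?thesis by simp
  qed (use off U in auto)
  then have "sigma_sets UNIV {U. open U} \<subseteq> sigma_sets UNIV R"
    by (intro sigma_sets_mono) auto
  moreover have "sigma_sets UNIV R \<subseteq> sigma_sets UNIV {U. open U}"
    by (intro sigma_sets_mono) (auto simp: R_def clopen_def)
  ultimately have eqs: "sigma_sets UNIV R = sets borel"
    by (simp add: borel_def)
  then show ?thesis by (simp add: R_def)
qed

text \<open>Finite additivity passes to the limit on the countable ring \<open>R\<close>, and
  Caratheodory's theorem extends the limit to a measure. Only sets that avoid \<open>z\<close> are
  assumed to have bounded mass, so the limit is finite on the ring but possibly infinite around
  \<open>z\<close>.\<close>

lemma vague_compactness:
  fixes s :: "nat \<Rightarrow> 'x::compact_zero_dim measure" and z :: 'x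
  assumes z: "open (- {z})" and sets: "\<And>k. sets (s k) = sets borel"
    and bound: "\<And>C. clopen C \<Longrightarrow> z \<notin> C \<Longrightarrow> \<exists>b<\<infinity>. \<forall>k. emeasure (s k) C \<le> b"
  obtains r \<sigma> where "strict_mono r" "sets \<sigma> = sets borel" "emeasure \<sigma> {z} = 0"
    "\<And>C. clopen C \<Longrightarrow> z \<notin> C \<Longrightarrow> emeasure \<sigma> C < \<infinity>"
    "\<And>C. clopen C \<Longrightarrow> z \<notin> C \<Longrightarrow> (\<lambda>k. measure (s (r k)) C) \<longlonglongrightarrow> measure \<sigma> C"
proof -
  define R where "R = {C. clopen C \<and> z \<notin> C}"
  have cR: "countable R" unfolding R_def by (rule countable_subset[OF _ countable_clopen]) auto
  have R0: "{} \<in> R" by (auto simp: R_def)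
  have borelR: "C \<in> sets borel" if "C \<in> R" for C
    using that by (auto simp: R_def clopen_def)
  have fin: "emeasure (s k) C \<noteq> \<infinity>" if C: "C \<in> R" for k C
  proof -
    obtain b where "b < \<infinity>" "emeasure (s k) C \<le> b"
      using bound[of C] C by (auto simp: R_def)
    then have "emeasure (s k) C < \<infinity>" by (rule le_less_trans[rotated])
    then show ?thesis by simp
  qed
  define e where "e = from_nat_into R"
  have e: "e n \<in> R" for n using R0 by (auto simp: e_def intro: from_nat_into)
  have e_surj: "\<exists>n. e n = C" if "C \<in> R" for C
    using from_nat_into_surj[OF cR that] by (auto simp: e_def)
  have "\<exists>b. \<forall>k. measure (s k) (e n) \<le> b" for n
  proof -
    obtain b where b: "b < \<infinity>" "\<And>k. emeasure (s k) (e n) \<le> b"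
      using bound[of "e n"] e[of n] by (auto simp: R_def)
    then have "measure (s k) (e n) \<le> enn2real b" for k
      by (simp add: measure_def enn2real_mono)
    then show ?thesis by blast
  qed
  then obtain b where b: "\<And>n k. measure (s k) (e n) \<le> b n" by metis
  obtain r l where r: "strict_mono r" and l: "\<And>n. (\<lambda>k. measure (s (r k)) (e n)) \<longlonglongrightarrow> l n"
    using pointwise_convergent_subsequence[of "\<lambda>n. 0" "\<lambda>k n. measure (s k) (e n)" b] b by auto
  define L where "L C = lim (\<lambda>k. measure (s (r k)) C)" for C
  have L: "(\<lambda>k. measure (s (r k)) C) \<longlonglongrightarrow> L C" if "C \<in> R" for C
    using e_surj[OF that] l by (metis L_def limI)
  have L0: "0 \<le> L C" if "C \<in> R" for C
    using L[OF that] by (rule LIMSEQ_le_const) auto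
  interpret ring_of_sets UNIV R
    by (rule ring_of_setsI) (auto simp: R_def)
  have "\<exists>\<mu>. (\<forall>C\<in>R. \<mu> C = ennreal (L C)) \<and> measure_space UNIV (sigma_sets UNIV R) \<mu>"
  proof (rule caratheodory_empty_continuous)
    have "L {} = 0" using L[OF R0] by (simp add: LIMSEQ_const_iff)
    then show "positive R (\<lambda>C. ennreal (L C))" by (simp add: positive_def)
    show "additive R (\<lambda>C. ennreal (L C))"
    proof (unfold additive_def, safe)
      fix A B assume AB: "A \<in> R" "B \<in> R" "A \<inter> B = {}"
      have "(\<lambda>k. measure (s (r k)) (A \<union> B)) \<longlonglongrightarrow> L A + L B"
      proof -
        have "measure (s (r k)) (A \<union> B) = measure (s (r k)) A + measure (s (r k)) B" for k
          using AB borelR fin by (intro measure_Union) (auto simp: sets)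
        then show ?thesis using tendsto_add[OF L[OF AB(1)] L[OF AB(2)]] by simp
      qed
      then have "L (A \<union> B) = L A + L B"
        using L[of "A \<union> B"] AB by (metis LIMSEQ_unique Un)
      then show "ennreal (L (A \<union> B)) = ennreal (L A) + ennreal (L B)"
        using L0 AB by (simp add: ennreal_plus)
    qed
    fix A :: "nat \<Rightarrow> 'x set"
    assume A: "range A \<subseteq> R" "decseq A" "(\<Inter>i. A i) = {}"
    \<comment> \<open>Decreasing clopen sets with empty intersection reach the empty set after
      finitely many steps, by compactness. Continuity at the empty set thus costs no
      estimate.\<close>
    have "\<exists>i. A i = {}"
    proof -
      have "UNIV \<subseteq> (\<Union>i\<in>UNIV. - A i)" using A(3) by auto
      moreover have "open (- A i)" for i using A(1) by (auto simp: R_def clopen_def)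
      ultimately obtain I where I: "finite I" "UNIV \<subseteq> (\<Union>i\<in>I. - A i)"
        using compactE_image[OF compact_univ, of UNIV "\<lambda>i. - A i"] by metis
      have "A (Max (insert 0 I)) \<subseteq> A i" if "i \<in> I" for i
        by (rule decseqD[OF A(2)]) (use I(1) that in auto)
      then show ?thesis using I(2) by blast
    qed
    then obtain i where "A i = {}" ..
    then have "A j = {}" if "j \<ge> i" for j
      using decseqD[OF A(2) that] by auto
    then have "eventually (\<lambda>j. ennreal (L (A j)) = 0) sequentially"
      using \<open>L {} = 0\<close> by (intro eventually_sequentiallyI[of i]) simp
    then show "(\<lambda>i. ennreal (L (A i))) \<longlonglongrightarrow> 0"
      by (rule tendsto_eventually)
  qed auto
  then obtain \<mu> where \<mu>: "\<And>C. C \<in> R \<Longrightarrow> \<mu> C = ennreal (L C)"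
    and ms: "measure_space UNIV (sigma_sets UNIV R) \<mu>" by auto
  have eqs: "sigma_sets UNIV R = sets borel"
    unfolding R_def using borel_eq_sigma_clopen_off[OF z] by simp
  define \<nu> where "\<nu> = measure_of UNIV (sets borel) \<mu>"
  have s\<nu>: "sets \<nu> = sets borel" using sets.sigma_sets_eq[of "borel :: 'x measure"] by (simp add: \<nu>_def)
  have e\<nu>: "emeasure \<nu> A = \<mu> A" if "A \<in> sets borel" for A
    unfolding \<nu>_def using ms that
    by (intro emeasure_measure_of_sigma) (auto simp: measure_space_def eqs)
  \<comment> \<open>No set of the ring contains \<open>z\<close>, so the extension may charge
    \<open>z\<close> arbitrarily. Deleting this atom changes no value on the ring.\<close>
  define \<sigma> where "\<sigma> = density \<nu> (indicator (- {z}))"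
  have zb: "- {z} \<in> sets borel" using z by auto
  have s\<sigma>: "sets \<sigma> = sets borel" by (simp add: \<sigma>_def s\<nu>)
  have e\<sigma>: "emeasure \<sigma> A = emeasure \<nu> (A - {z})" if "A \<in> sets borel" for A
  proof -
    have "emeasure \<sigma> A = (\<integral>\<^sup>+x. indicator (- {z}) x * indicator A x \<partial>\<nu>)"
      unfolding \<sigma>_def using that zb by (subst emeasure_density) (auto simp: s\<nu> intro!: borel_measurable_indicator)
    also have "\<dots> = (\<integral>\<^sup>+x. indicator (A - {z}) x \<partial>\<nu>)"
      by (intro nn_integral_cong) (auto simp: indicator_def)
    finally show ?thesis using that zb
      by (metis (no_types, lifting) Diff_eq nn_integral_indicator s\<nu> sets.Int)
  qed
  have e\<sigma>R: "emeasure \<sigma> C = ennreal (L C)" if "C \<in> R" for C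
  proof -
    have "C - {z} = C" using that by (auto simp: R_def)
    then show ?thesis using that borelR e\<sigma> e\<nu> \<mu> by simp
  qed
  show ?thesis
  proof (rule that[of r \<sigma>])
    have "closed {z}" using z by (simp add: open_closed)
    then show "emeasure \<sigma> {z} = 0" using e\<sigma>[of "{z}"] by auto
    show "emeasure \<sigma> C < \<infinity>" if "clopen C" "z \<notin> C" for C
      using that e\<sigma>R by (auto simp: R_def)
    show "(\<lambda>k. measure (s (r k)) C) \<longlonglongrightarrow> measure \<sigma> C" if "clopen C" "z \<notin> C" for C
      using that L[of C] e\<sigma>R[of C] L0[of C] by (auto simp: R_def measure_def)
  qed (use r s\<sigma> in auto)
qed

text \<open>The class of sets on which the setwise limit persists is a Dynkin class because the
  dominating measure controls the tails of disjoint unions uniformly in \<open>k\<close>.\<close>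

lemma dominated_setwise_convergence:
  fixes Y :: "nat \<Rightarrow> 'y measure"
  assumes sets: "\<And>k. sets (Y k) = sets m" "sets Y' = sets m"
    and dom: "\<And>k A. A \<in> sets m \<Longrightarrow> emeasure (Y k) A \<le> emeasure m A"
      "\<And>A. A \<in> sets m \<Longrightarrow> emeasure Y' A \<le> emeasure m A"
    and G: "Int_stable G" "G \<subseteq> Pow (space m)" "sets m = sigma_sets (space m) G"
    and conv: "\<And>A. A \<in> G \<Longrightarrow> (\<lambda>k. measure (Y k) A) \<longlonglongrightarrow> measure Y' A"
    and E: "range E \<subseteq> G" "incseq E" "(\<Union>i. E i) = space m" "\<And>i::nat. emeasure m (E i) < \<infinity>"
    and A: "A \<in> sets m" "emeasure m A < \<infinity>"
  shows "(\<lambda>k. measure (Y k) A) \<longlonglongrightarrow> measure Y' A"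
proof -
  define Z where "Z k = (case k of 0 \<Rightarrow> Y' | Suc k \<Rightarrow> Y k)" for k
  have Gm: "B \<in> sets m" if "B \<in> G" for B using G(3) that by auto
  have EG: "E i \<in> G" and Em: "E i \<in> sets m" for i using E(1) Gm by auto
  have finm: "emeasure m B < \<infinity>" if "B \<subseteq> C" "C \<in> sets m" "emeasure m C < \<infinity>" for B C
    using that emeasure_mono[of B C m] by (auto intro: le_less_trans)
  have finY: "emeasure (Y k) B \<noteq> \<infinity>" "emeasure Y' B \<noteq> \<infinity>" if "B \<in> sets m" "emeasure m B < \<infinity>" for k B
    using dom that by (metis infinity_ennreal_def leD top.not_eq_extremum)+
  have domr: "measure (Y k) B \<le> measure m B" "measure Y' B \<le> measure m B"
    if "B \<in> sets m" "emeasure m B < \<infinity>" for k B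
    unfolding measure_def using dom that by (auto intro!: enn2real_mono)
  have spc: "space (Y k) = space m" "space Y' = space m" for k
    using sets sets_eq_imp_space_eq by blast+
  \<comment> \<open>Replacing \<open>B\<close> by \<open>C n\<close> costs at most the
    \<open>m\<close>-measure of \<open>B - C n\<close>, a bound that does not involve
    \<open>k\<close>; hence one \<open>n\<close> serves the whole sequence and the limit.\<close>
  have approx: "(\<lambda>k. measure (Y k) B) \<longlonglongrightarrow> measure Y' B"
    if B: "B \<in> sets m" "emeasure m B < \<infinity>" and C: "\<And>n. C n \<in> sets m" "\<And>n. C n \<subseteq> B"
      "\<And>n. (\<lambda>k. measure (Y k) (C n)) \<longlonglongrightarrow> measure Y' (C n)"
      "(\<lambda>n. measure m (C n)) \<longlonglongrightarrow> measure m B" for B and C :: "nat \<Rightarrow> 'y set"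
  proof (rule LIMSEQ_I)
    fix e :: real assume "0 < e"
    then obtain n where n: "\<bar>measure m (C n) - measure m B\<bar> < e / 3"
      using LIMSEQ_D[OF C(4), of "e/3"] by (auto simp: )
    have fC: "emeasure m (C n) < \<infinity>" using finm C B by blast
    have d: "measure N B - measure N (C n) = measure N (B - C n)" if "sets N = sets m" "emeasure N B \<noteq> \<infinity>" for N
      using that B C by (subst measure_Diff) auto
    have diff: "B - C n \<in> sets m" "emeasure m (B - C n) < \<infinity>" using B C finm[of "B - C n" B] by auto
    have dm: "measure m (B - C n) < e/3"
    proof -
      have "measure m B - measure m (C n) = measure m (B - C n)" using d[of m] B(2) by simp
      then show ?thesis using n by linarith
    qed
    have 1: "\<bar>measure (Y k) B - measure (Y k) (C n)\<bar> < e / 3" for k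
      using d[of "Y k"] domr(1)[OF diff, of k] dm sets finY(1)[OF B] by auto
    have 2: "\<bar>measure Y' B - measure Y' (C n)\<bar> < e / 3"
      using d[of Y'] domr(2)[OF diff] dm sets finY(2)[OF B] by auto
    obtain k0 where k0: "\<And>k. k \<ge> k0 \<Longrightarrow> \<bar>measure (Y k) (C n) - measure Y' (C n)\<bar> < e/3"
      using LIMSEQ_D[OF C(3), of "e/3" n] \<open>0 < e\<close> by auto
    show "\<exists>k0. \<forall>k\<ge>k0. norm (measure (Y k) B - measure Y' B) < e"
    proof (intro exI allI impI)
      fix k assume "k \<ge> k0"
      then show "norm (measure (Y k) B - measure Y' B) < e"
        using 1[of k] 2 k0[of k] unfolding real_norm_def by linarith
    qed
  qed
  \<comment> \<open>Inside \<open>E i\<close> all masses are finite, so the complement step of the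
    Dynkin induction may subtract. The restriction is removed at the end by letting \<open>i\<close>
    grow.\<close>
  have inE: "(\<lambda>k. measure (Y k) (B \<inter> E i)) \<longlonglongrightarrow> measure Y' (B \<inter> E i)" if "B \<in> sigma_sets (space m) G" for B i
    using G(1,2) that
  proof (induction rule: sigma_sets_induct_disjoint)
    case (basic B)
    then show ?case using conv[of "B \<inter> E i"] G(1) E(1) by (auto simp: Int_stable_def image_subset_iff)
  next
    case empty
    then show ?case by simp
  next
    case (compl B)
    have B: "B \<in> sets m" "E i \<in> sets m" using compl G(3) Em by auto
    have *: "(space m - B) \<inter> E i = E i - B \<inter> E i"
      using sets.sets_into_space[OF B(2)] by auto
    have "measure N ((space m - B) \<inter> E i) = measure N (E i) - measure N (B \<inter> E i)"
      if "sets N = sets m" "emeasure N (E i) \<noteq> \<infinity>" for N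
      unfolding * using that B by (subst measure_Diff) auto
    then have "measure (Y k) ((space m - B) \<inter> E i) = measure (Y k) (E i) - measure (Y k) (B \<inter> E i)"
      "measure Y' ((space m - B) \<inter> E i) = measure Y' (E i) - measure Y' (B \<inter> E i)" for k
      using finY[OF B(2) E(4)] sets by auto
    moreover have "E i \<in> G" using E(1) by auto
    ultimately show ?case using tendsto_diff[OF conv[of "E i"] compl(2)] by simp
  next
    case (union B)
    have B: "B j \<in> sets m" "E i \<in> sets m" for j using union G(3) Em by auto
    have fB: "emeasure m (D \<inter> E i) < \<infinity>" for D using finm[OF _ B(2) E(4)] by simp
    have sumU: "measure N ((\<Union>j<n. B j) \<inter> E i) = (\<Sum>j<n. measure N (B j \<inter> E i))"
      if "sets N = sets m" "\<And>D. D \<in> sets m \<Longrightarrow> emeasure N (D \<inter> E i) \<noteq> \<infinity>" for N n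
    proof -
      have "(\<Union>j<n. B j) \<inter> E i = (\<Union>j<n. B j \<inter> E i)" by auto
      moreover have "measure N (\<Union>j<n. B j \<inter> E i) = (\<Sum>j<n. measure N (B j \<inter> E i))"
        using that B disjoint_family_onD[OF union(1)]
        by (intro measure_finite_Union) (auto simp: disjoint_family_on_def, blast)
      ultimately show ?thesis by simp
    qed
    show ?case
    proof (rule approx[where C="\<lambda>n. (\<Union>j<n. B j) \<inter> E i"])
      have "measure (Y k) ((\<Union>j<n. B j) \<inter> E i) = (\<Sum>j<n. measure (Y k) (B j \<inter> E i))"
       "measure Y' ((\<Union>j<n. B j) \<inter> E i) = (\<Sum>j<n. measure Y' (B j \<inter> E i))" for k n
        using B finY fB sets by (auto intro!: sumU)
      then show "(\<lambda>k. measure (Y k) ((\<Union>j<n. B j) \<inter> E i)) \<longlonglongrightarrow> measure Y' ((\<Union>j<n. B j) \<inter> E i)" for n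
        using union(3) by (simp add: tendsto_sum)
      have "(\<lambda>n. measure m ((\<Union>j<n. B j) \<inter> E i)) \<longlonglongrightarrow> measure m (\<Union>n. (\<Union>j<n. B j) \<inter> E i)"
      proof (rule Lim_measure_incseq)
        show "range (\<lambda>n. (\<Union>j<n. B j) \<inter> E i) \<subseteq> sets m" using B by auto
        show "incseq (\<lambda>n. (\<Union>j<n. B j) \<inter> E i)"
          by (rule monoI) (auto intro: less_le_trans)
        have "(\<Union>n. (\<Union>j<n. B j) \<inter> E i) = (\<Union>j. B j) \<inter> E i" by auto
        then show "emeasure m (\<Union>n. (\<Union>j<n. B j) \<inter> E i) \<noteq> \<infinity>"
          using fB[of "\<Union>j. B j"] by simp
      qed
      moreover have "(\<Union>n. (\<Union>j<n. B j) \<inter> E i) = (\<Union>j. B j) \<inter> E i" by auto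
      ultimately show "(\<lambda>n. measure m ((\<Union>j<n. B j) \<inter> E i)) \<longlonglongrightarrow> measure m ((\<Union>j. B j) \<inter> E i)"
        by simp
    qed (use B fB in auto)
  qed
  show ?thesis
  proof (rule approx[where C="\<lambda>n. A \<inter> E n", OF A])
    have "(\<lambda>n. measure m (A \<inter> E n)) \<longlonglongrightarrow> measure m (\<Union>n. A \<inter> E n)"
    proof (rule Lim_measure_incseq)
      show "range (\<lambda>n. A \<inter> E n) \<subseteq> sets m" using A Em by auto
      show "incseq (\<lambda>n. A \<inter> E n)" using E(2) by (auto simp: incseq_def)
      show "emeasure m (\<Union>n. A \<inter> E n) \<noteq> \<infinity>"
        using finm[of "\<Union>n. A \<inter> E n" A] A by auto
    qed
    moreover have "(\<Union>n. A \<inter> E n) = A" using E(3) sets.sets_into_space[OF A(1)] by auto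
    ultimately show "(\<lambda>n. measure m (A \<inter> E n)) \<longlonglongrightarrow> measure m A" by simp
    show "A \<inter> E n \<in> sets m" for n using A Em by auto
    show "(\<lambda>k. measure (Y k) (A \<inter> E n)) \<longlonglongrightarrow> measure Y' (A \<inter> E n)" for n
      using inE A(1) G(3) by simp
  qed auto
qed

text \<open>Indicators are covered by \<open>conv\<close> and sums are immediate. For an L1 limit,
  \<open>norm_le\<close> bounds the error under every \<open>Y k\<close> and under \<open>Y'\<close>
  by the same integral of \<open>\<bar>u i x - f x\<bar>\<close> with respect to \<open>m\<close>,
  so the approximation is uniform in \<open>k\<close>.\<close>

lemma dominated_integral_convergence:
  fixes Y :: "nat \<Rightarrow> 'y measure" and f :: "'y \<Rightarrow> real"
  assumes f: "integrable m f"
    and sets: "\<And>k. sets (Y k) = sets m" "sets Y' = sets m"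
    and dom: "\<And>k A. A \<in> sets m \<Longrightarrow> emeasure (Y k) A \<le> emeasure m A"
      "\<And>A. A \<in> sets m \<Longrightarrow> emeasure Y' A \<le> emeasure m A"
    and conv: "\<And>A. A \<in> sets m \<Longrightarrow> emeasure m A < \<infinity> \<Longrightarrow> (\<lambda>k. measure (Y k) A) \<longlonglongrightarrow> measure Y' A"
  shows "(\<lambda>k. integral\<^sup>L (Y k) f) \<longlonglongrightarrow> integral\<^sup>L Y' f"
proof -
  have le: "Y k \<le> m" "Y' \<le> m" for k
    using sets dom by (auto simp: le_measure)
  have int: "integrable N g" if "sets N = sets m" "N \<le> m" "integrable m g" for N and g :: "'y \<Rightarrow> real"
  proof (rule integrableI_bounded)
    show "g \<in> borel_measurable N" using that by (simp cong: measurable_cong_sets)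
    have "(\<integral>\<^sup>+x. ennreal (norm (g x)) \<partial>N) \<le> (\<integral>\<^sup>+x. ennreal (norm (g x)) \<partial>m)"
      using that by (intro nn_integral_mono_measure) auto
    also have "\<dots> < \<infinity>" using that(3) by (simp add: integrable_iff_bounded)
    finally show "(\<integral>\<^sup>+x. ennreal (norm (g x)) \<partial>N) < \<infinity>" .
  qed
  have norm_le: "\<bar>integral\<^sup>L N g\<bar> \<le> (\<integral>x. \<bar>g x\<bar> \<partial>m)"
    if "sets N = sets m" "N \<le> m" "integrable m g" for N and g :: "'y \<Rightarrow> real"
  proof -
    have "\<bar>integral\<^sup>L N g\<bar> \<le> (\<integral>x. \<bar>g x\<bar> \<partial>N)" by (rule integral_abs_bound)
    also have "\<dots> \<le> (\<integral>x. \<bar>g x\<bar> \<partial>m)"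
      using that int[OF that]
      by (simp add: integral_eq_nn_integral)
        (intro enn2real_mono nn_integral_mono_measure,
          auto simp: integrable_iff_bounded)
    finally show ?thesis .
  qed
  show ?thesis using f
  proof induct
    case (base A c)
    have "sets (Y k) = sets m" "A \<inter> space (Y k) = A" "A \<inter> space Y' = A" for k
      using sets base sets.sets_into_space[OF base(1)] sets_eq_imp_space_eq by (blast, metis inf.absorb1, metis inf.absorb1)
    then show ?case using conv[OF base] by (simp add: tendsto_mult_right)
  next
    case (add f g)
    then show ?case using int le sets by (simp add: tendsto_add)
  next
    case (lim f u)
    \<comment> \<open>The factor 3 in the majorant comes from the bound of \<open>u i x\<close> by
      twice \<open>\<bar>f x\<bar>\<close> that the induction rule supplies.\<close>
    have "(\<lambda>i. \<integral>x. \<bar>u i x - f x\<bar> \<partial>m) \<longlonglongrightarrow> (\<integral>x. \<bar>0::real\<bar> \<partial>m)"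
    proof (rule integral_dominated_convergence[where w="\<lambda>x. 3 * \<bar>f x\<bar>"])
      show "AE x in m. (\<lambda>i. \<bar>u i x - f x\<bar>) \<longlonglongrightarrow> \<bar>0\<bar>"
        using lim(3) by (intro AE_I2 tendsto_rabs LIM_zero) auto
      show "AE x in m. norm \<bar>u i x - f x\<bar> \<le> 3 * \<bar>f x\<bar>" for i
      proof (rule AE_I2)
        fix x assume "x \<in> space m"
        then show "norm \<bar>u i x - f x\<bar> \<le> 3 * \<bar>f x\<bar>" using lim(4)[of x i] by simp
      qed
    qed (use lim in auto)
    then have *: "(\<lambda>i. \<integral>x. \<bar>u i x - f x\<bar> \<partial>m) \<longlonglongrightarrow> 0" by simp
    show ?case
    proof (rule LIMSEQ_I)
      fix e :: real assume "0 < e"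
      then obtain i where i: "(\<integral>x. \<bar>u i x - f x\<bar> \<partial>m) < e/3"
        using LIMSEQ_D[OF *, of "e/3"] by fastforce
      have close: "\<bar>integral\<^sup>L N (u i) - integral\<^sup>L N f\<bar> < e/3" if "sets N = sets m" "N \<le> m" for N
        using norm_le[OF that, of "\<lambda>x. u i x - f x"] int[OF that] lim i by simp
      obtain k0 where k0: "\<And>k. k \<ge> k0 \<Longrightarrow> \<bar>integral\<^sup>L (Y k) (u i) - integral\<^sup>L Y' (u i)\<bar> < e/3"
        using LIMSEQ_D[OF lim(2)[of i], of "e/3"] \<open>0 < e\<close> by auto
      have "\<bar>integral\<^sup>L (Y k) f - integral\<^sup>L Y' f\<bar> < e" if "k \<ge> k0" for k
        using close[OF sets(1) le(1), of k] close[OF sets(2) le(2)] k0[OF that] by linarith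
      then show "\<exists>k0. \<forall>k\<ge>k0. norm (integral\<^sup>L (Y k) f - integral\<^sup>L Y' f) < e" by auto
    qed
  qed
qed

section \<open>The cut norm and images of measures\<close>

text \<open>The integral over \<open>T \<times> U\<close> of a kernel pulled back by
  \<open>h\<close> is an integral against the product of two such measures, one for \<open>T\<close>
  and one for \<open>U\<close>. This moves the test sets out of the integrand and into measures that
  can be compared with a marginal.\<close>

definition push :: "'a measure \<Rightarrow> 'a set \<Rightarrow> 'b measure \<Rightarrow> ('a \<Rightarrow> 'b) \<Rightarrow> 'b measure" where
  "push X T Y h = distr (density X (indicator T)) Y h"

lemma sets_push [simp, measurable_cong]: "sets (push X T Y h) = sets Y"
  by (simp add: push_def)

lemma space_push [simp]: "space (push X T Y h) = space Y"
  by (simp add: push_def)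

lemma emeasure_push:
  assumes "T \<in> sets X" "h \<in> measurable X Y" "B \<in> sets Y"
  shows "emeasure (push X T Y h) B = emeasure X (T \<inter> h -` B)"
proof -
  have "emeasure (push X T Y h) B = emeasure X (T \<inter> (h -` B \<inter> space X))"
    unfolding push_def using assms
    by (subst emeasure_distr) (auto simp: emeasure_restricted measurable_sets)
  also have "T \<inter> (h -` B \<inter> space X) = T \<inter> h -` B"
    using sets.sets_into_space[OF assms(1)] by auto
  finally show ?thesis .
qed

lemma push_space: "h \<in> measurable X Y \<Longrightarrow> push X (space X) Y h = distr X Y h"
  by (rule measure_eqI) (simp_all add: emeasure_push emeasure_distr Int_commute)

lemma sigma_finite_measure_mono:
  assumes "sigma_finite_measure m" "sets q = sets m" "\<And>A. A \<in> sets m \<Longrightarrow> emeasure q A \<le> emeasure m A"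
  shows "sigma_finite_measure q"
proof -
  interpret sigma_finite_measure m by fact
  obtain A where A: "countable A" "A \<subseteq> sets m" "\<Union>A = space m" "\<forall>a\<in>A. emeasure m a \<noteq> \<infinity>"
    using sigma_finite_countable by auto
  have "emeasure q a \<noteq> \<infinity>" if "a \<in> A" for a
    using assms(3)[of a] A that by (auto simp: top_unique)
  then show ?thesis
    using A assms(2) sets_eq_imp_space_eq[OF assms(2)] by unfold_locales auto
qed

lemma sigma_finite_density_indicator:
  assumes "sigma_finite_measure X" "T \<in> sets X"
  shows "sigma_finite_measure (density X (indicator T))"
  by (rule sigma_finite_measure_mono[OF assms(1)])
    (auto simp: emeasure_restricted[OF assms(2)] assms(2) intro!: emeasure_mono)

lemma pair_push:
  assumes X: "sigma_finite_measure X" and T: "T \<in> sets X" and U: "U \<in> sets X"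
    and h[measurable]: "h \<in> measurable X Y"
    and Y: "sigma_finite_measure (push X U Y h)"
  shows "push X T Y h \<Otimes>\<^sub>M push X U Y h
    = push (X \<Otimes>\<^sub>M X) (T \<times> U) (Y \<Otimes>\<^sub>M Y) (\<lambda>(x, y). (h x, h y))"
proof -
  note sf = sigma_finite_density_indicator[OF X]
  have "push X T Y h \<Otimes>\<^sub>M push X U Y h =
      distr (density X (indicator T) \<Otimes>\<^sub>M density X (indicator U)) (Y \<Otimes>\<^sub>M Y) (\<lambda>(x, y). (h x, h y))"
    unfolding push_def by (rule pair_measure_distr) (use Y in \<open>auto simp: push_def\<close>)
  also have "density X (indicator T) \<Otimes>\<^sub>M density X (indicator U)
      = density (X \<Otimes>\<^sub>M X) (\<lambda>(x, y). indicator T x * indicator U y)"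
    using T U by (intro pair_measure_density X sf) auto
  also have "(\<lambda>(x, y). indicator T x * indicator U y) = (indicator (T \<times> U) :: _ \<Rightarrow> ennreal)"
    by (auto simp: indicator_def fun_eq_iff)
  finally show ?thesis by (simp add: push_def)
qed

lemma
  fixes f :: "'b \<times> 'b \<Rightarrow> real"
  assumes X: "sigma_finite_measure X" and T: "T \<in> sets X" and U: "U \<in> sets X"
    and h[measurable]: "h \<in> measurable X Y"
    and Y: "sigma_finite_measure (push X U Y h)"
    and f[measurable]: "f \<in> borel_measurable (Y \<Otimes>\<^sub>M Y)"
  shows integral_pair_push: "integral\<^sup>L (push X T Y h \<Otimes>\<^sub>M push X U Y h) f
      = set_lebesgue_integral (X \<Otimes>\<^sub>M X) (T \<times> U) (\<lambda>z. f (h (fst z), h (snd z)))"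
    and integrable_pair_push: "integrable (push X T Y h \<Otimes>\<^sub>M push X U Y h) f
      \<longleftrightarrow> set_integrable (X \<Otimes>\<^sub>M X) (T \<times> U) (\<lambda>z. f (h (fst z), h (snd z)))"
proof -
  have [measurable]: "T \<times> U \<in> sets (X \<Otimes>\<^sub>M X)" using T U by auto
  \<comment> \<open>The indicator is written as the coercion of a real function because that is the
    form of density that \<open>integral_density\<close> accepts.\<close>
  have eq: "push X T Y h \<Otimes>\<^sub>M push X U Y h
    = distr (density (X \<Otimes>\<^sub>M X) (\<lambda>z. ennreal (indicator (T \<times> U) z))) (Y \<Otimes>\<^sub>M Y) (\<lambda>(x, y). (h x, h y))"
    using pair_push[OF assms(1-5)] by (simp add: push_def ennreal_indicator)
  show "integral\<^sup>L (push X T Y h \<Otimes>\<^sub>M push X U Y h) f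
      = set_lebesgue_integral (X \<Otimes>\<^sub>M X) (T \<times> U) (\<lambda>z. f (h (fst z), h (snd z)))"
    unfolding eq set_lebesgue_integral_def
    by (subst integral_distr, simp, simp, subst integral_density) (auto simp: case_prod_beta)
  show "integrable (push X T Y h \<Otimes>\<^sub>M push X U Y h) f
      \<longleftrightarrow> set_integrable (X \<Otimes>\<^sub>M X) (T \<times> U) (\<lambda>z. f (h (fst z), h (snd z)))"
    unfolding eq set_integrable_def
    by (subst integrable_distr_eq, simp, simp, subst integrable_density) (auto simp: case_prod_beta)
qed

section \<open>The cut norm: elementary bounds, images, and reduction to clopen rectangles\<close>

lemma cut_norm_upper:
  assumes "integrable (M \<Otimes>\<^sub>M M) (\<lambda>z. F (fst z) (snd z))" "T \<in> sets M" "U \<in> sets M"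
  shows "\<bar>set_lebesgue_integral (M \<Otimes>\<^sub>M M) (T \<times> U) (\<lambda>z. F (fst z) (snd z))\<bar> \<le> cut_norm M F"
proof -
  have "\<bar>set_lebesgue_integral (M \<Otimes>\<^sub>M M) (T \<times> U) (\<lambda>z. F (fst z) (snd z))\<bar>
      \<le> (\<integral>z. \<bar>F (fst z) (snd z)\<bar> \<partial>(M \<Otimes>\<^sub>M M))" if "T \<in> sets M" "U \<in> sets M" for T U
  proof -
    have "\<bar>set_lebesgue_integral (M \<Otimes>\<^sub>M M) (T \<times> U) (\<lambda>z. F (fst z) (snd z))\<bar>
      \<le> (\<integral>z. \<bar>indicat_real (T \<times> U) z *\<^sub>R F (fst z) (snd z)\<bar> \<partial>(M \<Otimes>\<^sub>M M))"
      unfolding set_lebesgue_integral_def by (rule integral_abs_bound)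
    also have "\<dots> \<le> (\<integral>z. \<bar>F (fst z) (snd z)\<bar> \<partial>(M \<Otimes>\<^sub>M M))"
      using assms(1) that
      by (intro integral_mono integrable_abs integrable_mult_indicator) (auto simp: indicator_def)
    finally show ?thesis .
  qed
  then have "bdd_above ((\<lambda>TU. \<bar>set_lebesgue_integral (M \<Otimes>\<^sub>M M) (fst TU \<times> snd TU)
      (\<lambda>z. F (fst z) (snd z))\<bar>) ` (sets M \<times> sets M))"
    by (intro bdd_aboveI2) (auto simp: mem_Times_iff)
  then show ?thesis
    unfolding cut_norm_def using assms(2,3) cSUP_upper[of "(T, U)" "sets M \<times> sets M"] by fastforce
qed

lemma cut_norm_least:
  assumes "\<And>T U. T \<in> sets M \<Longrightarrow> U \<in> sets M \<Longrightarrow>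
     \<bar>set_lebesgue_integral (M \<Otimes>\<^sub>M M) (T \<times> U) (\<lambda>z. F (fst z) (snd z))\<bar> \<le> c"
  shows "cut_norm M F \<le> c"
  unfolding cut_norm_def by (rule cSUP_least) (use assms in auto)

lemma cut_norm_nonneg:
  assumes "integrable (M \<Otimes>\<^sub>M M) (\<lambda>z. F (fst z) (snd z))"
  shows "0 \<le> cut_norm M F"
  using cut_norm_upper[OF assms, of "{}" "{}"] by simp

text \<open>Every rectangle of the image pulls back to a rectangle inside
  \<open>D \<times> D\<close>, so the left supremum runs over values that also occur on the right.
  The lemma is applied both to encode a coupling and to decode one.\<close>

lemma cut_norm_push_le:
  assumes X: "sigma_finite_measure X" and D: "D \<in> sets X"
    and h: "h \<in> measurable X Y"
    and Y: "sigma_finite_measure (push X D Y h)"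
    and F: "(\<lambda>z. F (fst z) (snd z)) \<in> borel_measurable (Y \<Otimes>\<^sub>M Y)"
    and G: "integrable (X \<Otimes>\<^sub>M X) (\<lambda>z. G (fst z) (snd z))"
      "\<And>x y. x \<in> space X \<Longrightarrow> y \<in> space X \<Longrightarrow> G x y = F (h x) (h y)"
  shows "cut_norm (push X D Y h) F \<le> cut_norm X G"
proof (rule cut_norm_least)
  fix T U assume TU: "T \<in> sets (push X D Y h)" "U \<in> sets (push X D Y h)"
  define T' U' where "T' = D \<inter> (h -` T \<inter> space X)" and "U' = D \<inter> (h -` U \<inter> space X)"
  have TU': "T' \<in> sets X" "U' \<in> sets X"
    using TU D h by (auto simp: T'_def U'_def)
  have [measurable]: "T \<in> sets Y" "U \<in> sets Y" using TU by auto
  have "set_lebesgue_integral (push X D Y h \<Otimes>\<^sub>M push X D Y h) (T \<times> U) (\<lambda>z. F (fst z) (snd z))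
    = set_lebesgue_integral (X \<Otimes>\<^sub>M X) (D \<times> D) (\<lambda>z. indicator (T \<times> U) (h (fst z), h (snd z)) *\<^sub>R F (h (fst z)) (h (snd z)))"
    unfolding set_lebesgue_integral_def[of "push X D Y h \<Otimes>\<^sub>M push X D Y h"]
    by (subst integral_pair_push[OF X D D h Y]) (use F in auto)
  also have "\<dots> = set_lebesgue_integral (X \<Otimes>\<^sub>M X) (T' \<times> U') (\<lambda>z. G (fst z) (snd z))"
    unfolding set_lebesgue_integral_def
    by (intro Bochner_Integration.integral_cong refl)
      (auto simp: indicator_def T'_def U'_def space_pair_measure G(2))
  finally show "\<bar>set_lebesgue_integral (push X D Y h \<Otimes>\<^sub>M push X D Y h) (T \<times> U) (\<lambda>z. F (fst z) (snd z))\<bar>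
      \<le> cut_norm X G"
    using cut_norm_upper[OF G(1) TU'] by simp
qed

text \<open>The sets that clopen sets approximate in \<open>L\<close> form a \<sigma>-algebra
  containing the clopen sets. A complement has the same symmetric difference; a countable union is
  cut off after finitely many sets, so that the approximating union remains clopen.\<close>

lemma clopen_approximation:
  fixes L :: "'x::compact_zero_dim measure"
  assumes L: "finite_measure L" "sets L = sets borel" and B: "B \<in> sets borel" and e: "0 < e"
  shows "\<exists>C. clopen C \<and> measure L ((B - C) \<union> (C - B)) < e"
proof -
  interpret finite_measure L by fact
  have spL: "space L = UNIV" using sets_eq_imp_space_eq[OF L(2)] by simp
  have "B \<in> sigma_sets UNIV {C :: 'x set. clopen C}" using B borel_eq_sigma_clopen by blast
  then show ?thesis using e
  proof (induction arbitrary: e)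
    case (Basic a)
    then show ?case by (intro exI[of _ a]) auto
  next
    case Empty
    then show ?case by (intro exI[of _ "{}"]) auto
  next
    case (Compl a)
    then obtain C where "clopen C" "measure L ((a - C) \<union> (C - a)) < e" by blast
    moreover have "((UNIV - a) - (- C)) \<union> (- C - (UNIV - a)) = (a - C) \<union> (C - a)" by auto
    ultimately show ?case by (intro exI[of _ "- C"]) auto
  next
    case (Union a)
    have a: "a i \<in> sets L" for i using Union(1) borel_eq_sigma_clopen L by auto
    have "(\<lambda>n. measure L (\<Union>i<n. a i)) \<longlonglongrightarrow> measure L (\<Union>n. \<Union>i<n. a i)"
      by (rule finite_Lim_measure_incseq) (use a in \<open>auto simp: incseq_def intro: less_le_trans\<close>)
    also have "(\<Union>n. \<Union>i<n. a i) = (\<Union>i. a i)" by auto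
    finally obtain n where n: "\<bar>measure L (\<Union>i<n. a i) - measure L (\<Union>i. a i)\<bar> < e / 2"
      using LIMSEQ_D[of _ _ "e/2"] \<open>0 < e\<close> by fastforce
    have "measure L ((\<Union>i. a i) - (\<Union>i<n. a i)) = measure L (\<Union>i. a i) - measure L (\<Union>i<n. a i)"
      using a by (intro finite_measure_Diff) auto
    with n have tail: "measure L ((\<Union>i. a i) - (\<Union>i<n. a i)) < e / 2" by linarith
    \<comment> \<open>The \<open>n\<close> errors add up to at most \<open>e / 2\<close>; the
      \<open>+ 1\<close> avoids a division by zero when \<open>n\<close> is 0.\<close>
    define d where "d = e / (2 * (real n + 1))"
    have "0 < d" using \<open>0 < e\<close> by (simp add: d_def)
    then obtain C where C: "\<And>i. clopen (C i)" "\<And>i. measure L ((a i - C i) \<union> (C i - a i)) < d"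
      using Union(2) by metis
    have Cb: "C i \<in> sets L" for i using C(1)[of i] L(2) by (auto simp: clopen_def)
    let ?D = "\<Union>i<n. C i"
    have "clopen ?D" using C(1) by (auto simp: clopen_def)
    moreover have "measure L (((\<Union>i. a i) - ?D) \<union> (?D - (\<Union>i. a i))) < e"
    proof -
      have "measure L (((\<Union>i. a i) - ?D) \<union> (?D - (\<Union>i. a i)))
        \<le> measure L (((\<Union>i. a i) - (\<Union>i<n. a i)) \<union> (\<Union>i<n. (a i - C i) \<union> (C i - a i)))"
        using a Cb by (intro finite_measure_mono) auto
      also have "\<dots> \<le> measure L ((\<Union>i. a i) - (\<Union>i<n. a i)) + measure L (\<Union>i<n. (a i - C i) \<union> (C i - a i))"
        using a Cb by (intro measure_Un_le) auto
      also have "measure L (\<Union>i<n. (a i - C i) \<union> (C i - a i)) \<le> (\<Sum>i<n. measure L ((a i - C i) \<union> (C i - a i)))"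
        using a Cb by (intro measure_UNION_le) auto
      also have "\<dots> \<le> (\<Sum>i<n. d)" using C(2) by (intro sum_mono less_imp_le) auto
      also have "\<dots> \<le> e / 2" using \<open>0 < e\<close> by (simp add: d_def field_simps)
      finally show ?thesis using tail by simp
    qed
    ultimately show ?case by blast
  qed
qed

text \<open>The measure \<open>D\<close> with density \<open>\<bar>F\<bar>\<close> is finite
  although \<open>M\<close> is only \<sigma>-finite, so its two marginals admit clopen
  approximation. Replacing \<open>T\<close> and \<open>U\<close> by clopen sets affects only the two
  strips \<open>?A\<close> and \<open>?B\<close> over the symmetric differences, and their
  \<open>D\<close>-mass bounds the change of the integral.\<close>

lemma cut_norm_le_clopen:
  fixes M :: "'x::compact_zero_dim measure"
  assumes M: "sets M = sets borel" "sigma_finite_measure M"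
    and F: "integrable (M \<Otimes>\<^sub>M M) (\<lambda>z. F (fst z) (snd z))"
    and c: "\<And>T U. clopen T \<Longrightarrow> clopen U \<Longrightarrow>
      \<bar>set_lebesgue_integral (M \<Otimes>\<^sub>M M) (T \<times> U) (\<lambda>z. F (fst z) (snd z))\<bar> \<le> c"
  shows "cut_norm M F \<le> c"
proof (rule cut_norm_least)
  let ?f = "\<lambda>z. F (fst z) (snd z)" and ?I = "\<lambda>A. set_lebesgue_integral (M \<Otimes>\<^sub>M M) A (\<lambda>z. F (fst z) (snd z))"
  fix T U assume TU: "T \<in> sets M" "U \<in> sets M"
  define D where "D = density (M \<Otimes>\<^sub>M M) (\<lambda>z. ennreal \<bar>?f z\<bar>)"
  have fm[measurable]: "?f \<in> borel_measurable (M \<Otimes>\<^sub>M M)" using F by auto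
  have "emeasure D (space D) < \<infinity>"
    unfolding D_def using F by (subst emeasure_density)
      (auto simp: integrable_iff_bounded cong: nn_integral_cong)
  then have "finite_measure D" by (intro finite_measureI) auto
  then interpret D: finite_measure D .
  have [measurable]: "fst \<in> measurable D M" "snd \<in> measurable D M"
    by (auto simp: D_def)
  have f12: "finite_measure (distr D M fst)" "finite_measure (distr D M snd)"
    by (auto intro!: D.finite_measure_distr)
  have int: "integrable (M \<Otimes>\<^sub>M M) (\<lambda>z. indicator A z * \<bar>?f z\<bar>)" "integrable (M \<Otimes>\<^sub>M M) (\<lambda>z. indicator A z * ?f z)"
    if "A \<in> sets (M \<Otimes>\<^sub>M M)" for A
    using integrable_mult_indicator[OF that F] integrable_mult_indicator[OF that integrable_abs[OF F]] by simp_all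
  have mD: "measure D A = (\<integral>z. indicator A z * \<bar>?f z\<bar> \<partial>(M \<Otimes>\<^sub>M M))" if "A \<in> sets (M \<Otimes>\<^sub>M M)" for A
  proof -
    have "emeasure D A = (\<integral>\<^sup>+z. ennreal (indicator A z * \<bar>?f z\<bar>) \<partial>(M \<Otimes>\<^sub>M M))"
      unfolding D_def using that by (subst emeasure_density)
        (auto intro!: nn_integral_cong simp: indicator_def)
    also have "\<dots> = ennreal (\<integral>z. indicator A z * \<bar>?f z\<bar> \<partial>(M \<Otimes>\<^sub>M M))"
      using F that by (intro nn_integral_eq_integral) (auto intro!: int)
    finally show ?thesis by (simp add: measure_def)
  qed
  show "\<bar>?I (T \<times> U)\<bar> \<le> c"
  proof (rule field_le_epsilon)
    fix e :: real assume "0 < e"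
    then have e: "0 < e/2" by simp
    obtain T' where T': "clopen T'" "measure (distr D M fst) ((T - T') \<union> (T' - T)) < e/2"
      using clopen_approximation[OF f12(1), of T "e/2"] e TU M by auto
    obtain U' where U': "clopen U'" "measure (distr D M snd) ((U - U') \<union> (U' - U)) < e/2"
      using clopen_approximation[OF f12(2), of U "e/2"] e TU M by auto
    let ?A = "((T - T') \<union> (T' - T)) \<times> UNIV" and ?B = "UNIV \<times> ((U - U') \<union> (U' - U))"
    have s: "T' \<in> sets M" "U' \<in> sets M" "UNIV \<in> sets M" using T' U' M by (auto simp: clopen_def)
    have sp: "space M = UNIV" using M(1) sets_eq_imp_space_eq[of M borel] by simp
    have "measure D ?A < e/2"
      using T' s TU by (subst (asm) measure_distr) (auto simp: D_def space_pair_measure sp vimage_fst Sigma_Un_distrib1)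
    moreover have "measure D ?B < e/2"
      using U' s TU by (subst (asm) measure_distr) (auto simp: D_def space_pair_measure sp vimage_snd Sigma_Un_distrib2)
    moreover have AB: "?A \<in> sets (M \<Otimes>\<^sub>M M)" "?B \<in> sets (M \<Otimes>\<^sub>M M)"
      "T \<times> U \<in> sets (M \<Otimes>\<^sub>M M)" "T' \<times> U' \<in> sets (M \<Otimes>\<^sub>M M)" using s TU by auto
    have "\<bar>?I (T \<times> U) - ?I (T' \<times> U')\<bar> \<le> measure D ?A + measure D ?B"
    proof -
      have "?I (T \<times> U) - ?I (T' \<times> U') = (\<integral>z. indicator (T \<times> U) z * ?f z - indicator (T' \<times> U') z * ?f z \<partial>(M \<Otimes>\<^sub>M M))"
        unfolding set_lebesgue_integral_def using int AB by simp
      also have "\<bar>\<dots>\<bar> \<le> (\<integral>z. \<bar>indicator (T \<times> U) z * ?f z - indicator (T' \<times> U') z * ?f z\<bar> \<partial>(M \<Otimes>\<^sub>M M))"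
        by (rule integral_abs_bound)
      also have "\<dots> \<le> (\<integral>z. indicator ?A z * \<bar>?f z\<bar> + indicator ?B z * \<bar>?f z\<bar> \<partial>(M \<Otimes>\<^sub>M M))"
        using int AB by (intro integral_mono integrable_abs Bochner_Integration.integrable_diff
            Bochner_Integration.integrable_add) (auto simp: indicator_def)
      also have "\<dots> = measure D ?A + measure D ?B" using int AB by (simp add: mD)
      finally show ?thesis .
    qed
    moreover have "\<bar>?I (T' \<times> U')\<bar> \<le> c" using c T' U' by blast
    ultimately show "\<bar>?I (T \<times> U)\<bar> \<le> c + e" by linarith
  qed
qed

section \<open>Couplings of codes\<close>

type_synonym code = "nat \<Rightarrow> bool"

abbreviation nocode :: code where
  "nocode \<equiv> \<lambda>_. False"

lemma clopen_coord [simp]: "clopen {c :: code. c i}"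
proof -
  have "clopen ((\<lambda>c :: code. c i) -` {True})"
    by (rule clopen_vimage) (auto simp: clopen_def open_discrete)
  then show ?thesis by (simp add: vimage_def)
qed

lemma Compl_nocode: "- {nocode} = (\<Union>i. {c. c i})"
  by (auto simp: fun_eq_iff)

lemma open_Compl_nocode [simp]: "open (- {nocode})"
  using clopen_coord unfolding Compl_nocode by (auto simp: clopen_def)

lemma open_Compl_nocode_pair [simp]: "open (- {(nocode, nocode)})"
proof -
  have "- {(nocode, nocode)} = (- {nocode}) \<times> UNIV \<union> UNIV \<times> (- {nocode})" by auto
  then show ?thesis by (simp add: open_Un open_Times)
qed

lemma nocode_borel [measurable]: "{nocode} \<in> sets borel" "{(nocode, nocode)} \<in> sets borel"
  using open_Compl_nocode open_Compl_nocode_pair by (auto simp: open_closed)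

text \<open>Membership of \<open>nocode\<close> is left free. Convergence is known only for clopen
  sets away from the zero pair, whereas generators that exhaust the space, such as
  \<open>code_cover\<close>, must contain \<open>nocode\<close>. The measures on codes that are
  compared give this point no mass, so both demands can be met.\<close>

definition off_clopens :: "code set set" where
  "off_clopens = {A. clopen (A - {nocode})}"

definition code_cover :: "nat \<Rightarrow> code set" where
  "code_cover i = {nocode} \<union> (\<Union>j<i. {c. c j})"

lemma off_clopens_borel: "A \<in> off_clopens \<Longrightarrow> A \<in> sets borel"
proof -
  assume "A \<in> off_clopens"
  then have "A - {nocode} \<in> sets borel" by (auto simp: off_clopens_def clopen_def)
  moreover from this have "{nocode} \<union> (A - {nocode}) \<in> sets borel"
    by (intro sets.Un nocode_borel)
  ultimately show "A \<in> sets borel" by (cases "nocode \<in> A") (auto simp: insert_absorb)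
qed

lemma Int_stable_off_clopens: "Int_stable off_clopens"
proof (rule Int_stableI)
  fix A B assume "A \<in> off_clopens" "B \<in> off_clopens"
  moreover have "A \<inter> B - {nocode} = (A - {nocode}) \<inter> (B - {nocode})" by auto
  ultimately show "A \<inter> B \<in> off_clopens" by (simp add: off_clopens_def)
qed

lemma borel_eq_sigma_off_clopens: "sets (borel :: code measure) = sigma_sets UNIV off_clopens"
proof
  have "{C. clopen C \<and> nocode \<notin> C} \<subseteq> off_clopens" by (auto simp: off_clopens_def)
  then show "sets (borel :: code measure) \<subseteq> sigma_sets UNIV off_clopens"
    unfolding borel_eq_sigma_clopen_off[OF open_Compl_nocode] by (rule sigma_sets_mono')
  show "sigma_sets UNIV off_clopens \<subseteq> sets (borel :: code measure)"
    using sets.sigma_sets_subset[of off_clopens "borel :: code measure"] off_clopens_borel by auto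
qed

lemma code_cover: "code_cover i \<in> off_clopens" "incseq code_cover" "(\<Union>i. code_cover i) = UNIV"
proof -
  have "code_cover i - {nocode} = (\<Union>j<i. {c. c j})" by (auto simp: code_cover_def)
  moreover have "clopen (\<Union>j<i. {c :: code. c j})"
    using clopen_coord by (auto simp: clopen_def)
  ultimately show "code_cover i \<in> off_clopens" by (simp add: off_clopens_def)
  show "incseq code_cover"
    by (auto simp: incseq_def code_cover_def)
  show "(\<Union>i. code_cover i) = UNIV"
    using Compl_nocode by (fastforce simp: code_cover_def)
qed

text \<open>The coordinate sets replace an exhaustion by sets of finite measure: they are clopen and
  cover every code except \<open>nocode\<close>. Finiteness on them is what a coding
  delivers.\<close>

definition code_measure :: "code measure \<Rightarrow> bool" where
  "code_measure m \<longleftrightarrow> sets m = sets borel \<and> emeasure m {nocode} = 0 \<and> (\<forall>i. emeasure m {c. c i} < \<infinity>)"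

lemma code_measure_cover_finite:
  assumes "code_measure m" shows "emeasure m (code_cover i) < \<infinity>"
proof -
  have b: "{c :: code. c j} \<in> sets borel" for j using clopen_coord[of j] by (auto simp: clopen_def)
  have "emeasure m (code_cover i) \<le> emeasure m {nocode} + emeasure m (\<Union>j<i. {c. c j})"
    unfolding code_cover_def using assms b
    by (intro emeasure_subadditive sets.finite_UN) (auto simp: code_measure_def)
  also have "\<dots> \<le> 0 + (\<Sum>j<i. emeasure m {c. c j})"
    using assms b by (intro add_mono emeasure_subadditive_finite) (auto simp: code_measure_def)
  also have "\<dots> < \<infinity>" using assms by (auto simp: code_measure_def)
  finally show ?thesis .
qed

lemma code_measure_sigma_finite: assumes "code_measure m" shows "sigma_finite_measure m"
proof
  have "sets m = sets borel" using assms by (simp add: code_measure_def)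
  then show "\<exists>A. countable A \<and> A \<subseteq> sets m \<and> \<Union>A = space m \<and> (\<forall>a\<in>A. emeasure m a \<noteq> \<infinity>)"
    using code_cover off_clopens_borel code_measure_cover_finite[OF assms] sets_eq_imp_space_eq[of m borel]
    by (intro exI[of _ "range code_cover"]) (auto simp: less_top)
qed

lemma code_measure_eqI:
  assumes "code_measure m" "sets m' = sets borel"
    and "\<And>A. A \<in> off_clopens \<Longrightarrow> emeasure m' A = emeasure m A"
  shows "m' = m"
proof (rule measure_eqI_generator_eq[OF Int_stable_off_clopens, where \<Omega>=UNIV and A=code_cover])
  show "emeasure m' (code_cover i) \<noteq> \<infinity>" for i
    using assms(3) code_cover(1) code_measure_cover_finite[OF assms(1)] by (simp add: less_top)
  show "sets m' = sigma_sets UNIV off_clopens" "sets m = sigma_sets UNIV off_clopens"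
    using assms(1,2) borel_eq_sigma_off_clopens by (auto simp: code_measure_def)
qed (use assms code_cover in auto)

lemma emeasure_pair_measure_mono:
  assumes "sigma_finite_measure m'" "sets q = sets m" "sets q' = sets m'"
    and le: "\<And>A. A \<in> sets m \<Longrightarrow> emeasure q A \<le> emeasure m A" "\<And>A. A \<in> sets m' \<Longrightarrow> emeasure q' A \<le> emeasure m' A"
    and A: "A \<in> sets (m \<Otimes>\<^sub>M m')"
  shows "emeasure (q \<Otimes>\<^sub>M q') A \<le> emeasure (m \<Otimes>\<^sub>M m') A"
proof -
  interpret m': sigma_finite_measure m' by fact
  interpret q': sigma_finite_measure q' by (rule sigma_finite_measure_mono[OF assms(1,3) le(2)])
  have [measurable_cong]: "sets q = sets m" "sets q' = sets m'" by fact+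
  have Aq: "A \<in> sets (q \<Otimes>\<^sub>M q')" using A by (metis assms(2,3) sets_pair_measure_cong)
  have "emeasure (q \<Otimes>\<^sub>M q') A = (\<integral>\<^sup>+x. emeasure q' (Pair x -` A) \<partial>q)"
    using Aq by (rule q'.emeasure_pair_measure_alt)
  also have "\<dots> \<le> (\<integral>\<^sup>+x. emeasure m' (Pair x -` A) \<partial>q)"
    using A by (intro nn_integral_mono le) (auto intro: sets_Pair1)
  also have "\<dots> \<le> (\<integral>\<^sup>+x. emeasure m' (Pair x -` A) \<partial>m)"
    using A assms(2) le by (intro nn_integral_mono_measure m'.measurable_emeasure_Pair) (auto simp: le_measure)
  also have "\<dots> = emeasure (m \<Otimes>\<^sub>M m') A"
    using A by (rule m'.emeasure_pair_measure_alt[symmetric])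
  finally show ?thesis .
qed

lemma push_le:
  assumes "D \<in> sets X" "T \<in> sets X" "T \<subseteq> D" "h \<in> measurable X Y" "A \<in> sets Y"
  shows "emeasure (push X T Y h) A \<le> emeasure (push X D Y h) A"
  unfolding emeasure_push[OF assms(1,4,5)] emeasure_push[OF assms(2,4,5)]
proof (rule emeasure_mono)
  have "D \<inter> h -` A = D \<inter> (h -` A \<inter> space X)" using sets.sets_into_space[OF assms(1)] by auto
  then show "D \<inter> h -` A \<in> sets X" using assms by (metis measurable_sets sets.Int)
qed (use assms in auto)

text \<open>The integral over \<open>T \<times> U\<close> sees \<open>s k\<close> only through the
  images \<open>q (s k) T\<close> and \<open>q (s k) U\<close> on codes. Both lie below
  \<open>m\<close> for every \<open>k\<close>, so their product lies below
  \<open>m \<Otimes>\<^sub>M m\<close>, with respect to which \<open>f\<close> is integrable. On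
  products of sets from \<open>off_clopens\<close> the image measure factors into masses of clopen
  sets; continuity of \<open>p\<close> makes these sets clopen and \<open>p z = nocode\<close> keeps
  them away from \<open>z\<close>, so \<open>conv\<close> applies.\<close>

lemma pair_integral_convergence:
  fixes s :: "nat \<Rightarrow> 'x::compact_zero_dim measure" and p :: "'x \<Rightarrow> code" and f :: "code \<times> code \<Rightarrow> real"
  assumes p: "continuous_on UNIV p" "p z = nocode" and m: "code_measure m"
    and s: "\<And>k. sets (s k) = sets borel" "\<And>k. sigma_finite_measure (s k)"
      "\<And>k. push (s k) (- p -` {nocode}) borel p = m"
    and \<sigma>: "sets \<sigma> = sets borel" "sigma_finite_measure \<sigma>" "push \<sigma> (- p -` {nocode}) borel p = m"
    and conv: "\<And>C. clopen C \<Longrightarrow> z \<notin> C \<Longrightarrow> (\<lambda>k. measure (s k) C) \<longlonglongrightarrow> measure \<sigma> C"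
    and f: "integrable (m \<Otimes>\<^sub>M m) f" "\<And>x y. x = nocode \<or> y = nocode \<Longrightarrow> f (x, y) = 0"
    and TU: "clopen T" "clopen U"
  shows "(\<lambda>k. set_lebesgue_integral (s k \<Otimes>\<^sub>M s k) (T \<times> U) (\<lambda>z. f (p (fst z), p (snd z))))
     \<longlonglongrightarrow> set_lebesgue_integral (\<sigma> \<Otimes>\<^sub>M \<sigma>) (T \<times> U) (\<lambda>z. f (p (fst z), p (snd z)))"
proof -
  \<comment> \<open>The part of \<open>A\<close> where \<open>p\<close> is \<open>nocode\<close>
    carries mass that \<open>m\<close> does not control. It is removed at no cost, since
    \<open>f\<close> vanishes there.\<close>
  define q where "q N A = push N (A - p -` {nocode}) borel p" for N A
  define good where "good N \<longleftrightarrow> sets N = sets borel \<and> sigma_finite_measure N \<and> push N (- p -` {nocode}) borel p = m" for N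
  have good: "good (s k)" "good \<sigma>" for k using s \<sigma> by (auto simp: good_def)
  have sm: "sets m = sets borel" using m by (simp add: code_measure_def)
  have spm: "space m = UNIV" using sets_eq_imp_space_eq[OF sm] by simp
  interpret m: sigma_finite_measure m by (rule code_measure_sigma_finite[OF m])
  have pm: "p \<in> measurable N borel" if "sets N = sets borel" for N
    using borel_measurable_continuous_onI[OF p(1)] that by (simp cong: measurable_cong_sets)
  have pv: "p -` {nocode} \<in> sets borel"
    using measurable_sets[OF pm[of borel] nocode_borel(1)] by simp
  have cb: "A \<in> sets borel" if "clopen A" for A :: "'x set" using that by (auto simp: clopen_def)
  have q_le: "emeasure (q N A) B \<le> emeasure m B" if "good N" "clopen A" "B \<in> sets borel" for N A B
  proof -
    have "emeasure (push N (A - p -` {nocode}) borel p) B \<le> emeasure (push N (- p -` {nocode}) borel p) B"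
      using that pm cb pv by (intro push_le) (auto simp: good_def)
    then show ?thesis using that by (simp add: q_def good_def)
  qed
  have sq: "sets (q N A) = sets m" for N A by (simp add: q_def sm)
  have q_sf: "sigma_finite_measure (q N A)" if "good N" "clopen A" for N A
    by (rule sigma_finite_measure_mono[OF m.sigma_finite_measure_axioms sq]) (use q_le that sm in auto)
  have fb: "f \<in> borel_measurable (borel \<Otimes>\<^sub>M borel)"
    using f(1) sm by (simp add: integrable_iff_bounded cong: measurable_cong_sets sets_pair_measure_cong)
  have eq: "integral\<^sup>L (q N T \<Otimes>\<^sub>M q N U) f
      = set_lebesgue_integral (N \<Otimes>\<^sub>M N) (T \<times> U) (\<lambda>z. f (p (fst z), p (snd z)))" if N: "good N" for N
  proof -
    have "integral\<^sup>L (q N T \<Otimes>\<^sub>M q N U) f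
      = set_lebesgue_integral (N \<Otimes>\<^sub>M N) ((T - p -` {nocode}) \<times> (U - p -` {nocode})) (\<lambda>z. f (p (fst z), p (snd z)))"
      unfolding q_def using N q_sf[OF N TU(2)] fb cb[OF TU(1)] cb[OF TU(2)] pv pm
      by (intro integral_pair_push) (auto simp: good_def q_def)
    also have "\<dots> = set_lebesgue_integral (N \<Otimes>\<^sub>M N) (T \<times> U) (\<lambda>z. f (p (fst z), p (snd z)))"
      unfolding set_lebesgue_integral_def
      by (intro Bochner_Integration.integral_cong refl) (auto simp: indicator_def f(2))
    finally show ?thesis .
  qed
  let ?G = "{a \<times> b | a b. a \<in> off_clopens \<and> b \<in> off_clopens}"
  have "(\<lambda>k. integral\<^sup>L (q (s k) T \<Otimes>\<^sub>M q (s k) U) f) \<longlonglongrightarrow> integral\<^sup>L (q \<sigma> T \<Otimes>\<^sub>M q \<sigma> U) f"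
  proof (rule dominated_integral_convergence[OF f(1)])
    show sets: "sets (q N T \<Otimes>\<^sub>M q N U) = sets (m \<Otimes>\<^sub>M m)" for N
      using sq by (intro sets_pair_measure_cong) auto
    show sets2: "sets (q \<sigma> T \<Otimes>\<^sub>M q \<sigma> U) = sets (m \<Otimes>\<^sub>M m)" by (rule sets)
    have dom: "emeasure (q N T \<Otimes>\<^sub>M q N U) A \<le> emeasure (m \<Otimes>\<^sub>M m) A"
      if "good N" "A \<in> sets (m \<Otimes>\<^sub>M m)" for N A
      using that TU q_le sm by (intro emeasure_pair_measure_mono m.sigma_finite_measure_axioms sq) auto
    then show dom1: "emeasure (q (s k) T \<Otimes>\<^sub>M q (s k) U) A \<le> emeasure (m \<Otimes>\<^sub>M m) A"
      and dom2: "emeasure (q \<sigma> T \<Otimes>\<^sub>M q \<sigma> U) A \<le> emeasure (m \<Otimes>\<^sub>M m) A"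
      if "A \<in> sets (m \<Otimes>\<^sub>M m)" for k A using that good by auto
    fix A assume A: "A \<in> sets (m \<Otimes>\<^sub>M m)" "emeasure (m \<Otimes>\<^sub>M m) A < \<infinity>"
    show "(\<lambda>k. measure (q (s k) T \<Otimes>\<^sub>M q (s k) U) A) \<longlonglongrightarrow> measure (q \<sigma> T \<Otimes>\<^sub>M q \<sigma> U) A"
    proof (rule dominated_setwise_convergence[where G="?G" and E="\<lambda>i. code_cover i \<times> code_cover i",
          OF sets sets2 dom1 dom2 _ _ _ _ _ _ _ _ A])
      show "Int_stable ?G"
        using Int_stable_off_clopens by (auto simp: Int_stable_def Times_Int_Times) blast
      show "?G \<subseteq> Pow (space (m \<Otimes>\<^sub>M m))" by (auto simp: space_pair_measure spm)
      have "sets (m \<Otimes>\<^sub>M m) = sets (sigma (space m \<times> space m) ?G)"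
        by (rule sets_pair_eq[where Ca="range code_cover" and Cb="range code_cover"])
          (use code_cover sm borel_eq_sigma_off_clopens spm in auto)
      then show "sets (m \<Otimes>\<^sub>M m) = sigma_sets (space (m \<Otimes>\<^sub>M m)) ?G"
        by (simp add: space_pair_measure spm)
      show "range (\<lambda>i. code_cover i \<times> code_cover i) \<subseteq> ?G" using code_cover by blast
      show "incseq (\<lambda>i. code_cover i \<times> code_cover i)"
        using code_cover(2) unfolding incseq_def by blast
      show "(\<Union>i. code_cover i \<times> code_cover i) = space (m \<Otimes>\<^sub>M m)"
      proof -
        have "\<exists>i. x \<in> code_cover i \<and> y \<in> code_cover i" for x y
        proof -
          obtain i j where "x \<in> code_cover i" "y \<in> code_cover j" using code_cover(3) by blast
          then show ?thesis
            using incseqD[OF code_cover(2), of i "max i j"] incseqD[OF code_cover(2), of j "max i j"] by auto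
        qed
        then show ?thesis by (auto simp: space_pair_measure spm)
      qed
      show "emeasure (m \<Otimes>\<^sub>M m) (code_cover i \<times> code_cover i) < \<infinity>" for i
        using code_measure_cover_finite[OF m, of i] code_cover(1)[of i] off_clopens_borel sm
        by (subst m.emeasure_pair_measure_Times) (auto simp: ennreal_mult_less_top)
      fix B assume "B \<in> ?G"
      then obtain a b where B: "B = a \<times> b" "a \<in> off_clopens" "b \<in> off_clopens" by auto
      have mul: "measure (q N T \<Otimes>\<^sub>M q N U) B = measure N (T \<inter> p -` (a - {nocode})) * measure N (U \<inter> p -` (b - {nocode}))"
        if N: "good N" for N
      proof -
        interpret qU: sigma_finite_measure "q N U" by (rule q_sf[OF N TU(2)])
        have ab: "a \<in> sets borel" "b \<in> sets borel" using B off_clopens_borel by auto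
        have *: "emeasure (q N C) d = emeasure N (C \<inter> p -` (d - {nocode}))" if "clopen C" "d \<in> sets borel" for C d
        proof -
          have "emeasure (q N C) d = emeasure N ((C - p -` {nocode}) \<inter> p -` d)"
            unfolding q_def using N that cb[of C] pv pm[of N] by (intro emeasure_push) (auto simp: good_def)
          also have "(C - p -` {nocode}) \<inter> p -` d = C \<inter> p -` (d - {nocode})" by auto
          finally show ?thesis .
        qed
        show ?thesis
          unfolding B(1) measure_def
          using ab by (subst qU.emeasure_pair_measure_Times) (auto simp: sq sm * TU enn2real_mult)
      qed
      have cl: "(\<lambda>k. measure (s k) (C \<inter> p -` (d - {nocode}))) \<longlonglongrightarrow> measure \<sigma> (C \<inter> p -` (d - {nocode}))"
        if "clopen C" "d \<in> off_clopens" for C d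
        using that p(2) by (intro conv clopen_simps(4) clopen_vimage[OF p(1)]) (auto simp: off_clopens_def)
      show "(\<lambda>k. measure (q (s k) T \<Otimes>\<^sub>M q (s k) U) B) \<longlonglongrightarrow> measure (q \<sigma> T \<Otimes>\<^sub>M q \<sigma> U) B"
        unfolding mul[OF good(1)] mul[OF good(2)] by (intro tendsto_mult cl TU B)
    qed
  qed
  then show ?thesis using eq good by simp
qed

text \<open>Mass on a pair with exactly one coordinate \<open>nocode\<close> represents points of
  one space matched with added points of the other. Prescribing the marginals only off
  \<open>nocode\<close> therefore admits every choice of trivial extension, and \<open>m1\<close>
  and \<open>m2\<close> may have different total mass. The zero pair is emptied to make the measure
  \<sigma>-finite and determined by visible data.\<close>

definition coded_coupling :: "code measure \<Rightarrow> code measure \<Rightarrow> (code \<times> code) measure \<Rightarrow> bool" where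
  "coded_coupling m1 m2 s \<longleftrightarrow> sets s = sets borel \<and> emeasure s {(nocode, nocode)} = 0
    \<and> push s (- fst -` {nocode}) borel fst = m1 \<and> push s (- snd -` {nocode}) borel snd = m2"

lemma coded_coupling_emeasure:
  assumes "coded_coupling m1 m2 s" "A \<in> sets borel"
  shows "emeasure m1 A = emeasure s (fst -` (A - {nocode}))"
    "emeasure m2 A = emeasure s (snd -` (A - {nocode}))"
proof -
  have s: "sets s = sets (borel \<Otimes>\<^sub>M borel)"
    using assms(1) unfolding coded_coupling_def borel_prod by blast
  have vimage_off: "- p -` {nocode} \<inter> p -` A = p -` (A - {nocode})" for p :: "code \<times> code \<Rightarrow> code"
    by auto
  have push: "push s (- fst -` {nocode}) borel fst = m1" "push s (- snd -` {nocode}) borel snd = m2"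
    using assms(1) unfolding coded_coupling_def by blast+
  have m: "fst \<in> measurable s borel" "snd \<in> measurable s borel"
    using s by (auto cong: measurable_cong_sets)
  have sp: "space s = UNIV" using sets_eq_imp_space_eq[OF s] by (simp add: space_pair_measure)
  have "- fst -` {nocode} \<in> sets s" "- snd -` {nocode} \<in> sets s"
    using measurable_sets[OF m(1), of "- {nocode}"] measurable_sets[OF m(2), of "- {nocode}"] by (auto simp: sp vimage_Compl)
  from emeasure_push[OF this(1) m(1) assms(2)] emeasure_push[OF this(2) m(2) assms(2)]
  show "emeasure m1 A = emeasure s (fst -` (A - {nocode}))"
    "emeasure m2 A = emeasure s (snd -` (A - {nocode}))"
    unfolding push vimage_off by simp_all
qed

text \<open>A pair other than the zero pair has a true coordinate in one of its codes, and the set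
  of all pairs with this coordinate has the finite mass prescribed by \<open>m1\<close> or
  \<open>m2\<close>.\<close>

lemma coded_coupling_sigma_finite:
  assumes "code_measure m1" "code_measure m2" "coded_coupling m1 m2 s"
  shows "sigma_finite_measure s"
proof
  have s: "sets s = sets borel" and z: "emeasure s {(nocode, nocode)} = 0"
    using assms(3) by (auto simp: coded_coupling_def)
  have sp: "space s = UNIV" using sets_eq_imp_space_eq[OF s] by simp
  have b: "{c :: code. c i} \<in> sets borel" for i using clopen_coord[of i] by (auto simp: clopen_def)
  have d: "{c :: code. c i} - {nocode} = {c. c i}" for i by auto
  have cl: "clopen (fst -` {c :: code. c i} :: (code \<times> code) set)" "clopen (snd -` {c :: code. c i} :: (code \<times> code) set)" for i
    by (rule clopen_vimage[OF _ clopen_coord], intro continuous_intros)+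
  have "emeasure s (fst -` {c. c i}) < \<infinity>" "emeasure s (snd -` {c. c i}) < \<infinity>" for i
  proof -
    have "emeasure m1 {c. c i} < \<infinity>" "emeasure m2 {c. c i} < \<infinity>"
      using assms(1,2) by (auto simp: code_measure_def)
    then show "emeasure s (fst -` {c. c i}) < \<infinity>" "emeasure s (snd -` {c. c i}) < \<infinity>"
      unfolding coded_coupling_emeasure[OF assms(3) b[of i]] d .
  qed
  moreover have "\<exists>i. fst x i \<or> snd x i" if "x \<noteq> (nocode, nocode)" for x :: "code \<times> code"
    using that by (cases x) (auto simp: fun_eq_iff)
  ultimately show "\<exists>A. countable A \<and> A \<subseteq> sets s \<and> \<Union>A = space s \<and> (\<forall>a\<in>A. emeasure s a \<noteq> \<infinity>)"
    using cl s z
    by (intro exI[of _ "{{(nocode, nocode)}} \<union> range (\<lambda>i. fst -` {c. c i}) \<union> range (\<lambda>i. snd -` {c. c i})"])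
      (auto simp: sp less_top clopen_def; blast)
qed

text \<open>A clopen set off the zero pair is compact, hence covered by finitely many coordinate
  sets whose masses \<open>m1\<close> and \<open>m2\<close> fix for all \<open>k\<close>; this is
  the uniform bound for \<open>vague_compactness\<close>. The marginals survive because the preimage
  of a set from \<open>off_clopens\<close>, without \<open>nocode\<close>, is itself such a clopen
  set and has the same mass for every \<open>k\<close>.\<close>

lemma coded_coupling_limit:
  fixes s :: "nat \<Rightarrow> (code \<times> code) measure"
  assumes m: "code_measure m1" "code_measure m2" and s: "\<And>k. coded_coupling m1 m2 (s k)"
  obtains r \<sigma> where "strict_mono r" "coded_coupling m1 m2 \<sigma>"
    "\<And>C. clopen C \<Longrightarrow> (nocode, nocode) \<notin> C \<Longrightarrow> (\<lambda>k. measure (s (r k)) C) \<longlonglongrightarrow> measure \<sigma> C"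
proof -
  let ?z = "(nocode, nocode)"
  have sets: "sets (s k) = sets borel" for k using s by (simp add: coded_coupling_def)
  have b: "{c :: code. c i} \<in> sets borel" for i using clopen_coord[of i] by (auto simp: clopen_def)
  have d: "{c :: code. c i} - {nocode} = {c. c i}" for i by auto
  have cl: "clopen (fst -` {c :: code. c i} :: (code \<times> code) set)" "clopen (snd -` {c :: code. c i} :: (code \<times> code) set)" for i
    by (rule clopen_vimage[OF _ clopen_coord], intro continuous_intros)+
  have bound: "\<exists>b<\<infinity>. \<forall>k. emeasure (s k) C \<le> b" if C: "clopen C" "?z \<notin> C" for C
  proof -
    let ?V = "\<lambda>i. fst -` {c. c i} \<union> snd -` {c. c i} :: (code \<times> code) set"
    have cC: "compact C" using compact_Int_closed[OF compact_univ, of C] C by (auto simp: clopen_def)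
    have oV: "open (?V i)" for i
      using cl[of i] unfolding clopen_def by (intro open_Un) blast+
    have "C \<subseteq> (\<Union>i\<in>UNIV. ?V i)"
    proof
      fix x assume "x \<in> C"
      then have "x \<noteq> ?z" using C by blast
      then show "x \<in> (\<Union>i\<in>UNIV. ?V i)" by (cases x) (auto simp: fun_eq_iff)
    qed
    then obtain I where I: "I \<subseteq> UNIV" "finite I" "C \<subseteq> (\<Union>i\<in>I. ?V i)"
      by (rule compactE_image[of C UNIV ?V, OF cC oV])
    have "emeasure (s k) C \<le> (\<Sum>i\<in>I. emeasure m1 {c. c i} + emeasure m2 {c. c i})" for k
    proof -
      have vb: "fst -` {c :: code. c i} \<in> sets (s k)" "snd -` {c :: code. c i} \<in> sets (s k)" for i
        using cl[of i] sets by (auto simp: clopen_def)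
      have "emeasure (s k) C \<le> emeasure (s k) (\<Union>i\<in>I. ?V i)"
        using I vb by (intro emeasure_mono sets.finite_UN) auto
      also have "\<dots> \<le> (\<Sum>i\<in>I. emeasure (s k) (?V i))"
        using I vb by (intro emeasure_subadditive_finite) auto
      also have "\<dots> \<le> (\<Sum>i\<in>I. emeasure m1 {c. c i} + emeasure m2 {c. c i})"
        unfolding coded_coupling_emeasure[OF s[of k] b] d
        using vb by (intro sum_mono emeasure_subadditive)
      finally show ?thesis .
    qed
    moreover have "(\<Sum>i\<in>I. emeasure m1 {c. c i} + emeasure m2 {c. c i}) < \<infinity>"
      using m I(2) by (auto simp: code_measure_def)
    ultimately show ?thesis by blast
  qed
  obtain r \<sigma> where r: "strict_mono r" and \<sigma>: "sets \<sigma> = sets borel" "emeasure \<sigma> {?z} = 0"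
    "\<And>C. clopen C \<Longrightarrow> ?z \<notin> C \<Longrightarrow> emeasure \<sigma> C < \<infinity>"
    "\<And>C. clopen C \<Longrightarrow> ?z \<notin> C \<Longrightarrow> (\<lambda>k. measure (s (r k)) C) \<longlonglongrightarrow> measure \<sigma> C"
  proof (rule vague_compactness[OF open_Compl_nocode_pair sets bound])
    fix r \<sigma> assume a: "strict_mono (r :: nat \<Rightarrow> nat)" "sets \<sigma> = sets borel" "emeasure \<sigma> {?z} = 0"
      "\<And>C. clopen C \<Longrightarrow> ?z \<notin> C \<Longrightarrow> emeasure \<sigma> C < \<infinity>"
      "\<And>C. clopen C \<Longrightarrow> ?z \<notin> C \<Longrightarrow> (\<lambda>k. measure (s (r k)) C) \<longlonglongrightarrow> measure \<sigma> C"
    show thesis by (rule that[OF a])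
  qed
  have marg: "push \<sigma> (- p -` {nocode}) borel p = m"
    if p: "continuous_on UNIV p" "p ?z = nocode" and m: "code_measure m"
      and sm: "\<And>k A. A \<in> sets borel \<Longrightarrow> emeasure m A = emeasure (s k) (p -` (A - {nocode}))" for p m
  proof (rule code_measure_eqI[OF m])
    fix A assume A: "A \<in> off_clopens"
    have pm: "p \<in> measurable \<sigma> borel"
      using borel_measurable_continuous_onI[OF p(1)] \<sigma>(1) by (simp cong: measurable_cong_sets)
    have sp: "space \<sigma> = UNIV" using sets_eq_imp_space_eq[OF \<sigma>(1)] by simp
    have pv: "- p -` {nocode} \<in> sets \<sigma>"
      using measurable_sets[OF pm, of "- {nocode}"] by (simp add: sp vimage_Compl)
    let ?C = "p -` (A - {nocode})"
    have C: "clopen ?C" "?z \<notin> ?C" using A p by (auto intro!: clopen_vimage simp: off_clopens_def)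
    have Ab: "A \<in> sets borel" using A by (rule off_clopens_borel)
    have "emeasure (push \<sigma> (- p -` {nocode}) borel p) A = emeasure \<sigma> ?C"
      unfolding emeasure_push[OF pv pm Ab] by (rule arg_cong[where f="emeasure \<sigma>"]) auto
    moreover have "measure \<sigma> ?C = measure m A"
    proof (rule LIMSEQ_unique[OF \<sigma>(4)[OF C]])
      show "(\<lambda>k. measure (s (r k)) ?C) \<longlonglongrightarrow> measure m A"
        using sm[OF Ab] by (simp add: measure_def)
    qed
    moreover have "emeasure \<sigma> ?C < \<infinity>" "emeasure m A < \<infinity>"
      using \<sigma>(3)[OF C] bound[OF C] unfolding sm[OF Ab, of 0] by (auto intro: le_less_trans)
    ultimately show "emeasure (push \<sigma> (- p -` {nocode}) borel p) A = emeasure m A"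
      by (simp add: emeasure_eq_ennreal_measure less_top)
  qed simp
  have "coded_coupling m1 m2 \<sigma>"
    unfolding coded_coupling_def
    using \<sigma>(1,2) m coded_coupling_emeasure[OF s]
    by (auto intro!: marg continuous_on_fst continuous_on_snd continuous_on_id)
  then show ?thesis using that r \<sigma> by blast
qed

section \<open>Kernels on codes and the optimal coded coupling\<close>

definition code_kernel :: "code measure \<Rightarrow> (code \<Rightarrow> code \<Rightarrow> real) \<Rightarrow> bool" where
  "code_kernel m w \<longleftrightarrow> integrable (m \<Otimes>\<^sub>M m) (\<lambda>z. w (fst z) (snd z))
    \<and> (\<forall>x y. x = nocode \<or> y = nocode \<longrightarrow> w x y = 0)"

definition code_diff :: "(code \<Rightarrow> code \<Rightarrow> real) \<Rightarrow> (code \<Rightarrow> code \<Rightarrow> real) \<Rightarrow> code \<times> code \<Rightarrow> code \<times> code \<Rightarrow> real" where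
  "code_diff w1 w2 x y = w1 (fst x) (fst y) - w2 (snd x) (snd y)"

text \<open>As \<open>w\<close> vanishes once an argument is \<open>nocode\<close>, only the part of
  \<open>s\<close> over \<open>- {nocode}\<close> matters, and \<open>p\<close> carries that part to
  \<open>m\<close>.\<close>

lemma code_kernel_integrable:
  assumes s: "sigma_finite_measure s" "p \<in> measurable s borel" "- p -` {nocode} \<in> sets s"
    and m: "push s (- p -` {nocode}) borel p = m" "sigma_finite_measure m"
    and w: "code_kernel m w"
  shows "integrable (s \<Otimes>\<^sub>M s) (\<lambda>z. w (p (fst z)) (p (snd z)))"
proof -
  let ?D = "- p -` {nocode}"
  have [measurable]: "(\<lambda>z. w (fst z) (snd z)) \<in> borel_measurable (borel \<Otimes>\<^sub>M borel)"
  proof -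
    have "sets (m \<Otimes>\<^sub>M m) = sets (borel \<Otimes>\<^sub>M borel)"
      using m(1) by (intro sets_pair_measure_cong) auto
    then show ?thesis using w unfolding code_kernel_def
      by (metis borel_measurable_integrable measurable_cong_sets)
  qed
  have "set_integrable (s \<Otimes>\<^sub>M s) (?D \<times> ?D) (\<lambda>z. w (p (fst z)) (p (snd z)))"
    using integrable_pair_push[OF s(1) s(3) s(3) s(2), of "\<lambda>z. w (fst z) (snd z)"] m w
    by (simp add: code_kernel_def)
  moreover have "(\<lambda>z. indicator (?D \<times> ?D) z *\<^sub>R w (p (fst z)) (p (snd z))) = (\<lambda>z. w (p (fst z)) (p (snd z)))"
    using w by (intro ext) (auto simp: code_kernel_def indicator_def)
  ultimately show ?thesis unfolding set_integrable_def by simp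
qed

lemma coded_coupling_kernels_integrable:
  assumes m: "code_measure m1" "code_measure m2" and s: "coded_coupling m1 m2 s"
    and w: "code_kernel m1 w1" "code_kernel m2 w2"
  shows "integrable (s \<Otimes>\<^sub>M s) (\<lambda>z. w1 (fst (fst z)) (fst (snd z)))"
    and "integrable (s \<Otimes>\<^sub>M s) (\<lambda>z. w2 (snd (fst z)) (snd (snd z)))"
    and "integrable (s \<Otimes>\<^sub>M s) (\<lambda>z. code_diff w1 w2 (fst z) (snd z))"
proof -
  have ss: "sets s = sets (borel \<Otimes>\<^sub>M borel)"
    using s unfolding coded_coupling_def borel_prod by blast
  have ms: "fst \<in> measurable s borel" "snd \<in> measurable s borel"
    using ss by (auto cong: measurable_cong_sets)
  have sp: "space s = UNIV" using sets_eq_imp_space_eq[OF ss] by (simp add: space_pair_measure)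
  have D: "- fst -` {nocode} \<in> sets s" "- snd -` {nocode} \<in> sets s"
    using measurable_sets[OF ms(1), of "- {nocode}"] measurable_sets[OF ms(2), of "- {nocode}"]
    by (auto simp: sp vimage_Compl)
  have sf: "sigma_finite_measure s" by (rule coded_coupling_sigma_finite[OF m s])
  show 1: "integrable (s \<Otimes>\<^sub>M s) (\<lambda>z. w1 (fst (fst z)) (fst (snd z)))"
    using s by (intro code_kernel_integrable[OF sf ms(1) D(1) _ code_measure_sigma_finite[OF m(1)] w(1)])
      (simp add: coded_coupling_def)
  show 2: "integrable (s \<Otimes>\<^sub>M s) (\<lambda>z. w2 (snd (fst z)) (snd (snd z)))"
    using s by (intro code_kernel_integrable[OF sf ms(2) D(2) _ code_measure_sigma_finite[OF m(2)] w(2)])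
      (simp add: coded_coupling_def)
  show "integrable (s \<Otimes>\<^sub>M s) (\<lambda>z. code_diff w1 w2 (fst z) (snd z))"
    unfolding code_diff_def using 1 2 by simp
qed

lemma optimal_coded_coupling:
  assumes m: "code_measure m1" "code_measure m2"
    and w: "code_kernel m1 w1" "code_kernel m2 w2"
    and ex: "coded_coupling m1 m2 s0"
  obtains \<sigma> where "coded_coupling m1 m2 \<sigma>"
    "\<And>s. coded_coupling m1 m2 s \<Longrightarrow> cut_norm \<sigma> (code_diff w1 w2) \<le> cut_norm s (code_diff w1 w2)"
proof -
  let ?F = "code_diff w1 w2"
  note int = coded_coupling_kernels_integrable[OF m _ w]
  define V where "V = {cut_norm s ?F | s. coded_coupling m1 m2 s}"
  have V: "V \<noteq> {}" "bdd_below V"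
    using ex cut_norm_nonneg[OF int(3)] by (auto simp: V_def intro!: bdd_belowI[of _ 0])
  have "\<exists>s. coded_coupling m1 m2 s \<and> cut_norm s ?F < Inf V + inverse (real (Suc k))" for k
    using cInf_lessD[OF V(1), of "Inf V + inverse (real (Suc k))"] by (auto simp: V_def)
  then obtain s where s: "\<And>k. coded_coupling m1 m2 (s k)"
    and cut_s: "\<And>k. cut_norm (s k) ?F < Inf V + inverse (real (Suc k))" by metis
  obtain r \<sigma> where r: "strict_mono r" and \<sigma>: "coded_coupling m1 m2 \<sigma>"
    and conv: "\<And>C. clopen C \<Longrightarrow> (nocode, nocode) \<notin> C \<Longrightarrow> (\<lambda>k. measure (s (r k)) C) \<longlonglongrightarrow> measure \<sigma> C"
    using coded_coupling_limit[of m1 m2 s, OF m s] by metis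
  have p: "continuous_on UNIV (fst :: code \<times> code \<Rightarrow> code)" "continuous_on UNIV (snd :: code \<times> code \<Rightarrow> code)"
    by (intro continuous_intros)+
  have sf: "sigma_finite_measure t" if "coded_coupling m1 m2 t" for t
    by (rule coded_coupling_sigma_finite[OF m that])
  have ss: "sets (s k) = sets borel" "push (s k) (- fst -` {nocode}) borel fst = m1"
    "push (s k) (- snd -` {nocode}) borel snd = m2" for k
    using s by (auto simp only: coded_coupling_def)
  have s\<sigma>: "sets \<sigma> = sets borel" "push \<sigma> (- fst -` {nocode}) borel fst = m1"
    "push \<sigma> (- snd -` {nocode}) borel snd = m2"
    using \<sigma> by (auto simp only: coded_coupling_def)
  have w0: "x = nocode \<or> y = nocode \<Longrightarrow> w1 x y = 0" "x = nocode \<or> y = nocode \<Longrightarrow> w2 x y = 0" for x y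
    using w unfolding code_kernel_def by blast+
  let ?I = "\<lambda>t T U. set_lebesgue_integral (t \<Otimes>\<^sub>M t) (T \<times> U) (\<lambda>z. ?F (fst z) (snd z))"
  have "cut_norm \<sigma> ?F \<le> Inf V"
  proof (rule cut_norm_le_clopen)
    show "sets \<sigma> = sets borel" using \<sigma> by (simp add: coded_coupling_def)
    fix T U :: "(code \<times> code) set" assume TU: "clopen T" "clopen U"
    \<comment> \<open>Each kernel is integrable against its own marginal only, so the two integrals
      go to the limit separately and are recombined before taking absolute values.\<close>
    have split: "?I t T U = set_lebesgue_integral (t \<Otimes>\<^sub>M t) (T \<times> U) (\<lambda>z. w1 (fst (fst z)) (fst (snd z)))
       - set_lebesgue_integral (t \<Otimes>\<^sub>M t) (T \<times> U) (\<lambda>z. w2 (snd (fst z)) (snd (snd z)))"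
      if t: "coded_coupling m1 m2 t" for t
    proof -
      have "T \<times> U \<in> sets (t \<Otimes>\<^sub>M t)"
        using TU t by (intro pair_measureI) (auto simp: clopen_def coded_coupling_def)
      then show ?thesis
        unfolding code_diff_def using int(1,2)[OF t]
        by (intro set_integral_diff; unfold set_integrable_def; intro integrable_mult_indicator)
    qed
    have "(\<lambda>k. set_lebesgue_integral (s (r k) \<Otimes>\<^sub>M s (r k)) (T \<times> U) (\<lambda>z. w1 (fst (fst z)) (fst (snd z))))
      \<longlonglongrightarrow> set_lebesgue_integral (\<sigma> \<Otimes>\<^sub>M \<sigma>) (T \<times> U) (\<lambda>z. w1 (fst (fst z)) (fst (snd z)))"
      using pair_integral_convergence[OF p(1) _ m(1) ss(1) sf[OF s] ss(2) s\<sigma>(1) sf[OF \<sigma>] s\<sigma>(2) conv,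
          where z="(nocode, nocode)" and f="\<lambda>z. w1 (fst z) (snd z)" and T=T and U=U] w0(1) w(1) TU by (simp add: code_kernel_def)
    moreover have "(\<lambda>k. set_lebesgue_integral (s (r k) \<Otimes>\<^sub>M s (r k)) (T \<times> U) (\<lambda>z. w2 (snd (fst z)) (snd (snd z))))
      \<longlonglongrightarrow> set_lebesgue_integral (\<sigma> \<Otimes>\<^sub>M \<sigma>) (T \<times> U) (\<lambda>z. w2 (snd (fst z)) (snd (snd z)))"
      using pair_integral_convergence[OF p(2) _ m(2) ss(1) sf[OF s] ss(3) s\<sigma>(1) sf[OF \<sigma>] s\<sigma>(3) conv,
          where z="(nocode, nocode)" and f="\<lambda>z. w2 (fst z) (snd z)" and T=T and U=U] w0(2) w(2) TU by (simp add: code_kernel_def)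
    ultimately have "(\<lambda>k. \<bar>?I (s (r k)) T U\<bar>) \<longlonglongrightarrow> \<bar>?I \<sigma> T U\<bar>"
      unfolding split[OF \<sigma>] split[OF s] by (intro tendsto_rabs tendsto_diff)
    moreover have "(\<lambda>k. Inf V + inverse (real (Suc k))) \<longlonglongrightarrow> Inf V"
      using tendsto_add[OF tendsto_const[of "Inf V"] LIMSEQ_inverse_real_of_nat] by simp
    moreover have "\<bar>?I (s (r k)) T U\<bar> \<le> Inf V + inverse (real (Suc k))" for k
    proof -
      have "\<bar>?I (s (r k)) T U\<bar> \<le> cut_norm (s (r k)) ?F"
        using TU s by (intro cut_norm_upper int(3)) (auto simp: clopen_def coded_coupling_def)
      also have "\<dots> \<le> Inf V + inverse (real (Suc (r k)))" using cut_s[of "r k"] by simp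
      also have "\<dots> \<le> Inf V + inverse (real (Suc k))"
        using seq_suble[OF r, of k] by (simp add: le_imp_inverse_le)
      finally show ?thesis .
    qed
    ultimately show "\<bar>?I \<sigma> T U\<bar> \<le> Inf V"
      by (blast intro: LIMSEQ_le)
  qed (use \<sigma> sf int in auto)
  moreover have "Inf V \<le> cut_norm s ?F" if "coded_coupling m1 m2 s" for s
    using V that by (intro cInf_lower) (auto simp: V_def)
  ultimately show ?thesis using that \<sigma> order_trans by blast
qed

section \<open>Coding Borel spaces\<close>

text \<open>Only the \<sigma>-algebra is meant: \<open>sigma\<close> carries the zero measure, and
  the actual measures are put on it later by \<open>distr\<close>. The naturals under
  \<open>Inr\<close> are a countable discrete supply of new points, enough to spread the added mass
  in finite portions.\<close>

definition ext_space :: "'a measure \<Rightarrow> ('a + real) measure" where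
  "ext_space M = sigma (Inl ` space M \<union> Inr ` \<nat>) ((`) Inl ` sets M \<union> (`) Inr ` Pow \<nat>)"

definition ext_kernel :: "('a \<Rightarrow> 'a \<Rightarrow> real) \<Rightarrow> 'a + real \<Rightarrow> 'a + real \<Rightarrow> real" where
  "ext_kernel W y y' = (case (y, y') of (Inl x, Inl x') \<Rightarrow> W x x' | _ \<Rightarrow> 0)"

lemma ext_kernel_simps [simp]:
  "ext_kernel W (Inl x) (Inl x') = W x x'" "ext_kernel W (Inr r) y = 0" "ext_kernel W y (Inr r) = 0"
  by (auto simp: ext_kernel_def split: sum.split)

lemma ext_gen_Pow: "(`) Inl ` sets M \<union> (`) Inr ` Pow \<nat> \<subseteq> Pow (Inl ` space M \<union> Inr ` \<nat>)"
  using sets.sets_into_space by fastforce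

lemma space_ext_space: "space (ext_space M) = Inl ` space M \<union> Inr ` \<nat>"
  unfolding ext_space_def using ext_gen_Pow by (rule space_measure_of)

lemma sets_ext_space: "sets (ext_space M) =
    sigma_sets (Inl ` space M \<union> Inr ` \<nat>) ((`) Inl ` sets M \<union> (`) Inr ` Pow \<nat>)"
  unfolding ext_space_def using ext_gen_Pow by (rule sets_measure_of)

lemma Inl_in_ext_space [intro]: "A \<in> sets M \<Longrightarrow> Inl ` A \<in> sets (ext_space M)"
  unfolding sets_ext_space by (rule sigma_sets.Basic) auto

lemma Inr_in_ext_space [intro]: "B \<subseteq> \<nat> \<Longrightarrow> Inr ` B \<in> sets (ext_space M)"
  unfolding sets_ext_space by (rule sigma_sets.Basic) auto

lemma measurable_ext_spaceI:
  assumes f: "\<And>x. x \<in> space N \<Longrightarrow> f x \<in> Inl ` space M \<union> Inr ` \<nat>"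
    and l: "\<And>A. A \<in> sets M \<Longrightarrow> f -` Inl ` A \<inter> space N \<in> sets N"
    and r: "\<And>B. B \<subseteq> \<nat> \<Longrightarrow> f -` Inr ` B \<inter> space N \<in> sets N"
  shows "f \<in> measurable N (ext_space M)"
  unfolding ext_space_def by (rule measurable_measure_of[OF ext_gen_Pow]) (use assms in auto)

lemma measurable_Inl_ext_space [measurable]:
  fixes M :: "'a measure" shows "Inl \<in> measurable M (ext_space M)"
proof (rule measurable_ext_spaceI)
  fix A assume "A \<in> sets M"
  moreover have "(Inl :: 'a \<Rightarrow> 'a + real) -` Inl ` A \<inter> space M = A" using sets.sets_into_space[OF \<open>A \<in> sets M\<close>] by auto
  ultimately show "(Inl :: 'a \<Rightarrow> 'a + real) -` Inl ` A \<inter> space M \<in> sets M" by (simp only:)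
next
  fix B :: "real set"
  have "(Inl :: 'a \<Rightarrow> 'a + real) -` Inr ` B \<inter> space M = {}" by auto
  then show "(Inl :: 'a \<Rightarrow> 'a + real) -` Inr ` B \<inter> space M \<in> sets M" by simp
qed auto

text \<open>Measurability of \<open>g\<close> is asked only where \<open>P\<close> holds, because
  the inverse of a Borel isomorphism is given on a Borel subset only.\<close>

lemma measurable_ext_If:
  assumes P: "{x \<in> space N. P x} \<in> sets N" and g: "g \<in> measurable (restrict_space N {x. P x}) M"
    and h: "h \<in> measurable N (count_space (UNIV :: nat set))"
  shows "(\<lambda>x. if P x then Inl (g x) else Inr (real (h x))) \<in> measurable N (ext_space M)"
proof (subst measurable_If_restrict_space_iff[OF P], intro conjI)
  show "(\<lambda>x. Inl (g x)) \<in> measurable (restrict_space N {x. P x}) (ext_space M)"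
    using g by (rule measurable_compose) (rule measurable_Inl_ext_space)
  have "(\<lambda>n :: nat. Inr (real n)) \<in> measurable (count_space UNIV) (ext_space M)"
    by (auto simp: space_ext_space)
  then show "(\<lambda>x. Inr (real (h x))) \<in> measurable (restrict_space N {x. \<not> P x}) (ext_space M)"
    using measurable_compose[OF measurable_restrict_space1[OF h]] by blast
qed

lemma measurable_ext_kernel:
  assumes W: "(\<lambda>z. W (fst z) (snd z)) \<in> borel_measurable (M \<Otimes>\<^sub>M M)"
  shows "(\<lambda>z. ext_kernel W (fst z) (snd z)) \<in> borel_measurable (ext_space M \<Otimes>\<^sub>M ext_space M)"
proof (cases "space M = {}")
  case True
  then have "ext_kernel W (fst z) (snd z) = 0" if "z \<in> space (ext_space M \<Otimes>\<^sub>M ext_space M)" for z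
    using that by (auto simp: space_pair_measure space_ext_space)
  then show ?thesis by (subst measurable_cong[of _ _ "\<lambda>_. 0"]) auto
next
  case False
  then obtain x0 where x0: "x0 \<in> space M" by auto
  \<comment> \<open>\<open>q\<close> retracts the extension to \<open>M\<close>. New points go to an
    arbitrary \<open>x0\<close>, which does no harm as the indicator below cancels their values; the
    need for \<open>x0\<close> forces the case of empty \<open>M\<close> to be separate.\<close>
  define q where "q y = (case y of Inl x \<Rightarrow> x | Inr (_ :: real) \<Rightarrow> x0)" for y
  have [measurable]: "q \<in> measurable (ext_space M) M"
  proof (rule measurableI)
    show "y \<in> space (ext_space M) \<Longrightarrow> q y \<in> space M" for y
      using x0 by (auto simp: q_def space_ext_space)
    fix A assume A: "A \<in> sets M"
    have "q -` A \<inter> space (ext_space M) = Inl ` A \<union> (if x0 \<in> A then Inr ` \<nat> else {})"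
      using sets.sets_into_space[OF A] by (auto simp: q_def space_ext_space split: sum.split_asm)
    also have "\<dots> \<in> sets (ext_space M)" using A by auto
    finally show "q -` A \<inter> space (ext_space M) \<in> sets (ext_space M)" .
  qed
  have [measurable]: "Inl ` space M \<in> sets (ext_space M)" by auto
  have "ext_kernel W (fst z) (snd z) = indicator (Inl ` space M \<times> Inl ` space M) z * W (q (fst z)) (q (snd z))"
    if "z \<in> space (ext_space M \<Otimes>\<^sub>M ext_space M)" for z
    using that by (auto simp: space_pair_measure space_ext_space q_def indicator_def)
  moreover have "(\<lambda>z. W (q (fst z)) (q (snd z))) \<in> borel_measurable (ext_space M \<Otimes>\<^sub>M ext_space M)"
    using measurable_compose[of "\<lambda>z. (q (fst z), q (snd z))", OF _ W] by simp
  ultimately show ?thesis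
    by (subst measurable_cong) (assumption, intro borel_measurable_times borel_measurable_indicator, auto)
qed

text \<open>The point \<open>nocode\<close> plays the part of a cemetery: it is the code of everything that lies
  outside the original space.\<close>

definition coding :: "'a measure \<Rightarrow> ('a \<Rightarrow> code) \<Rightarrow> (code \<Rightarrow> 'a + real) \<Rightarrow> bool" where
  "coding M e d \<longleftrightarrow> e \<in> measurable M borel \<and> (\<forall>x\<in>space M. e x \<noteq> nocode)
    \<and> (\<forall>i. emeasure M {x\<in>space M. e x i} < \<infinity>)
    \<and> d \<in> measurable borel (ext_space M) \<and> (\<forall>x\<in>space M. d (e x) = Inl x)
    \<and> (\<forall>c. d c \<in> Inl ` space M \<or> d c = Inr 0) \<and> d nocode = Inr 0"

lemma measurable_bool_borel: "measurable M (borel :: bool measure) = measurable M (count_space UNIV)"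
  by (rule measurable_cong_sets[OF refl sets_borel_eq_count_space])

lemma pred_code [measurable]: "Measurable.pred (borel :: code measure) (\<lambda>c. c i)"
  unfolding measurable_bool_borel[symmetric] by (rule measurable_product_coordinates)

lemma borel_measurable_codeI:
  assumes "\<And>i. Measurable.pred M (\<lambda>x. f x i)"
  shows "f \<in> measurable M (borel :: code measure)"
  by (rule measurable_coordinatewise_then_product) (unfold measurable_bool_borel, rule assms)

text \<open>A point is coded by the list of balls around a dense sequence that contain it, each
  refined by a cover of finite measure. It is decoded as the limit of the first centres of the
  balls of radius \<open>1/2^l\<close>, which avoids any appeal to the Lusin-Souslin theorem.\<close>

lemma ex_coding:
  fixes M :: "'a measure"
  assumes "borel_msp TYPE('p::polish_space) M" "sigma_finite_measure M"
  obtains e d where "coding M e d"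
proof -
  obtain B :: "'p set" and f g where B: "B \<in> sets borel"
    and f: "f \<in> measurable M (restrict_space borel B)" and g: "g \<in> measurable (restrict_space borel B) M"
    and fg: "\<And>x. x \<in> space M \<Longrightarrow> f x \<in> B \<and> g (f x) = x" "\<And>y. y \<in> B \<Longrightarrow> g y \<in> space M \<and> f (g y) = y"
    using assms(1) unfolding borel_msp_def by blast
  interpret sigma_finite_measure M by fact
  obtain S :: "nat \<Rightarrow> 'a set" where S: "range S \<subseteq> sets M" "(\<Union>i. S i) = space M" "\<And>i. emeasure M (S i) \<noteq> \<infinity>"
    using sigma_finite by blast
  obtain D :: "'p set" where D: "countable D" "\<And>X. open X \<Longrightarrow> X \<noteq> {} \<Longrightarrow> \<exists>d\<in>D. d \<in> X"
    by (rule countable_dense_setE) blast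
  define q where "q = from_nat_into D"
  have q: "\<exists>j. dist y (q j) < r" if r: "0 < r" for y r
  proof -
    obtain p where "p \<in> D" "p \<in> ball y r" using D(2)[of "ball y r"] r by auto
    then show ?thesis using from_nat_into_surj[OF D(1)] by (auto simp: q_def mem_ball)
  qed
  define enc where "enc n j l = prod_encode (n, prod_encode (j, l))" for n j l
  define e where "e x i = (case prod_decode i of (n, m) \<Rightarrow> case prod_decode m of (j, l) \<Rightarrow>
      x \<in> S n \<and> dist (f x) (q j) < (1/2) ^ l)" for x i
  have e_enc: "e x (enc n j l) \<longleftrightarrow> x \<in> S n \<and> dist (f x) (q j) < (1/2) ^ l" for x n j l
    by (simp add: e_def enc_def)
  \<comment> \<open>The index \<open>n\<close> of the finite-measure cover is forgotten in decoding:
    a centre counts as listed if it is listed for some \<open>n\<close>.\<close>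
  define a where "a l c = q (LEAST j. \<exists>n. c (enc n j l))" for l and c :: code
  \<comment> \<open>Completeness makes Cauchy the same as convergent. Sequences without a limit
    arise only from codes outside the range of \<open>e\<close>, and \<open>q 0\<close> is a default
    that keeps \<open>v\<close> total.\<close>
  define v where "v c = (if Cauchy (\<lambda>l. a l c) then lim (\<lambda>l. a l c) else q 0)" for c
  \<comment> \<open>\<open>nocode\<close> is excluded explicitly, since the limit
    \<open>v nocode\<close> could lie in \<open>B\<close>. Writing \<open>real 0\<close> matches the
    shape of \<open>measurable_ext_If\<close>.\<close>
  define d where "d c = (if c \<noteq> nocode \<and> v c \<in> B then Inl (g (v c)) else Inr (real 0))" for c
  have fb[measurable]: "f \<in> borel_measurable M"
    using f B by (simp add: measurable_restrict_space2_iff)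
  have Sm[measurable]: "S n \<in> sets M" for n using S by auto
  have "Measurable.pred M (\<lambda>x. e x i)" for i
    unfolding e_def by (cases "prod_decode i"; cases "prod_decode (snd (prod_decode i))") simp
  then have em: "e \<in> measurable M borel" by (rule borel_measurable_codeI)
  have [measurable]: "a l \<in> borel_measurable borel" for l
    unfolding a_def by measurable
  have vm[measurable]: "v \<in> borel_measurable borel"
  proof (rule borel_measurable_LIMSEQ_metric[of "\<lambda>l c. if Cauchy (\<lambda>l. a l c) then a l c else q 0"])
    show "(\<lambda>c. if Cauchy (\<lambda>l. a l c) then a l c else q 0) \<in> borel_measurable borel" for l
      by measurable
    show "(\<lambda>l. if Cauchy (\<lambda>l. a l c) then a l c else q 0) \<longlonglongrightarrow> v c" for c
      by (auto simp: v_def Cauchy_convergent_iff convergent_LIMSEQ_iff)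
  qed
  \<comment> \<open>Every centre listed in \<open>e x\<close> at level \<open>l\<close> is within
    \<open>(1/2) ^ l\<close> of \<open>f x\<close>, in particular the one of least index, so the
    selected centres converge to \<open>f x\<close>.\<close>
  have v_e: "v (e x) = f x" if x: "x \<in> space M" for x
  proof -
    obtain n where n: "x \<in> S n" using S x by blast
    have "dist (f x) (a l (e x)) < (1/2) ^ l" for l
    proof -
      obtain j where "dist (f x) (q j) < (1/2) ^ l" using q[of "(1/2)^l" "f x"] by auto
      then have "\<exists>n. e x (enc n j l)" using n by (auto simp: e_enc)
      then have "\<exists>n. e x (enc n (LEAST j. \<exists>n. e x (enc n j l)) l)"
        by (rule LeastI[of "\<lambda>j. \<exists>n. e x (enc n j l)"])
      then show ?thesis unfolding a_def using e_enc[THEN iffD1] by blast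
    qed
    then have "dist (a l (e x)) (f x) \<le> (1/2) ^ l" for l
      by (simp add: dist_commute less_imp_le)
    then have ev: "\<forall>\<^sub>F l in sequentially. norm (dist (a l (e x)) (f x)) \<le> (1/2) ^ l" by simp
    have "(\<lambda>l. (1/2 :: real) ^ l) \<longlonglongrightarrow> 0" by (rule LIMSEQ_power_zero) simp
    with ev have "(\<lambda>l. dist (a l (e x)) (f x)) \<longlonglongrightarrow> 0" by (rule Lim_null_comparison)
    then have "(\<lambda>l. a l (e x)) \<longlonglongrightarrow> f x" by (rule tendsto_dist_iff[THEN iffD2])
    then show ?thesis using LIMSEQ_imp_Cauchy limI by (simp add: v_def) blast
  qed
  have e_ne: "e x \<noteq> nocode" if x: "x \<in> space M" for x
  proof -
    obtain n where n: "x \<in> S n" using S x by blast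
    obtain j where "dist (f x) (q j) < (1/2) ^ 0" using q[of 1 "f x"] by auto
    with n have "e x (enc n j 0)" by (simp add: e_enc)
    then show ?thesis by auto
  qed
  have "emeasure M {x \<in> space M. e x i} < \<infinity>" for i
  proof -
    have "emeasure M {x \<in> space M. e x i} \<le> emeasure M (S (fst (prod_decode i)))"
      by (intro emeasure_mono) (auto simp: e_def case_prod_beta)
    also have "\<dots> < \<infinity>" using S(3) by (simp add: less_top)
    finally show ?thesis .
  qed
  moreover have "d \<in> measurable borel (ext_space M)"
    unfolding d_def
  proof (rule measurable_ext_If)
    show P: "{c \<in> space borel. c \<noteq> nocode \<and> v c \<in> B} \<in> sets borel"
    proof -
      have "{c \<in> space borel. c \<noteq> nocode \<and> v c \<in> B} = (v -` B \<inter> space borel) - {nocode}" by auto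
      then show ?thesis using measurable_sets[OF vm B] by auto
    qed
    have "v \<in> measurable (restrict_space borel {c. c \<noteq> nocode \<and> v c \<in> B}) (restrict_space borel B)"
      by (rule measurable_restrict_space2) (auto simp: space_restrict_space intro: measurable_restrict_space1)
    then show "(\<lambda>c. g (v c)) \<in> measurable (restrict_space borel {c. c \<noteq> nocode \<and> v c \<in> B}) M"
      using g by (rule measurable_compose)
  qed simp
  ultimately have "coding M e d"
    unfolding coding_def using em e_ne v_e fg by (auto simp: d_def)
  then show ?thesis by (rule that)
qed

section \<open>Transport of a graphon to codes\<close>

definition code_distr :: "'a measure \<Rightarrow> ('a \<Rightarrow> code) \<Rightarrow> code measure" where
  "code_distr M e = distr M borel e"

definition coded_kernel :: "('a \<Rightarrow> 'a \<Rightarrow> real) \<Rightarrow> (code \<Rightarrow> 'a + real) \<Rightarrow> code \<Rightarrow> code \<Rightarrow> real" where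
  "coded_kernel W d = pullback d (ext_kernel W)"

lemma code_measure_code_distr:
  assumes "coding M e d" shows "code_measure (code_distr M e)"
proof -
  have e: "e \<in> measurable M borel" using assms by (simp add: coding_def)
  have "e -` {nocode} \<inter> space M = {}" using assms by (auto simp: coding_def)
  moreover have "e -` {c. c i} \<inter> space M = {x \<in> space M. e x i}" for i by auto
  moreover have "{c :: code. c i} \<in> sets borel" for i using clopen_coord[of i] by (auto simp: clopen_def)
  ultimately show ?thesis
    using assms e by (auto simp: code_measure_def code_distr_def emeasure_distr coding_def)
qed

lemma measurable_coded_kernel:
  assumes "coding M e d" "graphon M W"
  shows "(\<lambda>z. coded_kernel W d (fst z) (snd z)) \<in> borel_measurable (borel \<Otimes>\<^sub>M borel)"
proof -
  have [measurable]: "d \<in> measurable borel (ext_space M)" using assms by (simp add: coding_def)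
  have "(\<lambda>z. ext_kernel W (fst z) (snd z)) \<in> borel_measurable (ext_space M \<Otimes>\<^sub>M ext_space M)"
    using assms(2) by (intro measurable_ext_kernel) (auto simp: graphon_def)
  from measurable_compose[OF _ this, of "\<lambda>z. (d (fst z), d (snd z))" "borel \<Otimes>\<^sub>M borel"]
  show ?thesis by (simp add: coded_kernel_def pullback_def)
qed

text \<open>Because \<open>d (e x) = Inl x\<close>, pulling the coded kernel back along
  \<open>e\<close> returns \<open>W\<close>, so its integrability is that of
  \<open>W\<close>.\<close>

lemma code_kernel_coded_kernel:
  assumes c: "coding M e d" and W: "graphon M W"
  shows "code_kernel (code_distr M e) (coded_kernel W d)"
proof -
  have e: "e \<in> measurable M borel" using c by (simp add: coding_def)
  have eq: "push M (space M) borel e = code_distr M e" using e by (simp add: push_space code_distr_def)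
  have sf: "sigma_finite_measure M" using W by (simp add: graphon_def)
  have int: "integrable (M \<Otimes>\<^sub>M M) (\<lambda>z. W (fst z) (snd z))" using W by (simp add: graphon_def)
  have "set_integrable (M \<Otimes>\<^sub>M M) (space M \<times> space M) (\<lambda>z. coded_kernel W d (e (fst z)) (e (snd z)))
    \<longleftrightarrow> integrable (M \<Otimes>\<^sub>M M) (\<lambda>z. W (fst z) (snd z))"
    unfolding set_integrable_def
    by (intro Bochner_Integration.integrable_cong refl)
      (use c in \<open>auto simp: space_pair_measure coding_def coded_kernel_def pullback_def\<close>)
  then have "integrable (code_distr M e \<Otimes>\<^sub>M code_distr M e) (\<lambda>z. coded_kernel W d (fst z) (snd z))"
    using integrable_pair_push[OF sf sets.top sets.top e, of "\<lambda>z. coded_kernel W d (fst z) (snd z)"] int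
      code_measure_sigma_finite[OF code_measure_code_distr[OF c]] measurable_coded_kernel[OF c W]
    by (simp add: eq)
  then show ?thesis using c by (auto simp: code_kernel_def coded_kernel_def pullback_def coding_def)
qed

section \<open>From couplings to codes and back\<close>

definition ext_code :: "'a measure \<Rightarrow> ('a \<Rightarrow> code) \<Rightarrow> ('a \<Rightarrow> 'c) \<Rightarrow> 'c \<Rightarrow> code" where
  "ext_code M e \<iota> y = (if y \<in> \<iota> ` space M then e (the_inv_into (space M) \<iota> y) else nocode)"

lemma ext_code_image:
  assumes "trivial_extension M W \<iota> M' W'" "x \<in> space M"
  shows "ext_code M e \<iota> (\<iota> x) = e x"
  using assms by (auto simp: ext_code_def trivial_extension_def the_inv_into_f_f)

text \<open>A trivial extension fixes the measure of images under \<open>\<iota>\<close>, so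
  preimages under the extended code are rewritten as such images. The set \<open>B\<close> must
  avoid \<open>nocode\<close>, the code of all added points.\<close>

lemma ext_code_vimage:
  assumes te: "trivial_extension M W \<iota> M' W'" and "nocode \<notin> B"
  shows "ext_code M e \<iota> -` B \<inter> space M' = \<iota> ` (e -` B \<inter> space M)"
proof -
  have "\<iota> \<in> measurable M M'" using te by (simp add: trivial_extension_def)
  then have "\<iota> x \<in> space M'" if "x \<in> space M" for x using that by (rule measurable_space)
  moreover have "y \<in> \<iota> ` (e -` B \<inter> space M)" if y: "ext_code M e \<iota> y \<in> B" for y
  proof -
    obtain x where "x \<in> space M" "y = \<iota> x"
      using y assms(2) by (auto simp: ext_code_def split: if_splits)
    then show ?thesis using y ext_code_image[OF te] by auto
  qed
  ultimately show ?thesis using ext_code_image[OF te] by auto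
qed

lemma measurable_ext_code:
  assumes te: "trivial_extension M W \<iota> M' W'" and e: "e \<in> measurable M borel"
  shows "ext_code M e \<iota> \<in> measurable M' borel"
proof (rule borel_measurable_codeI)
  fix i
  have "{c :: code. c i} \<in> sets borel" using clopen_coord[of i] by (auto simp: clopen_def)
  then have "e -` {c. c i} \<inter> space M \<in> sets M" using e by (rule measurable_sets[rotated])
  then have "\<iota> ` (e -` {c. c i} \<inter> space M) \<in> sets M'" using te by (auto simp: trivial_extension_def)
  then have "ext_code M e \<iota> -` {c. c i} \<inter> space M' \<in> sets M'"
    using ext_code_vimage[OF te, of "{c. c i}"] by simp
  moreover have "ext_code M e \<iota> -` {c. c i} \<inter> space M' = {y \<in> space M'. ext_code M e \<iota> y i}" by auto
  ultimately show "Measurable.pred M' (\<lambda>y. ext_code M e \<iota> y i)" by (simp add: pred_def)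
qed

lemma emeasure_ext_code:
  assumes te: "trivial_extension M W \<iota> M' W'" and e: "e \<in> measurable M borel"
    and B: "B \<in> sets borel" "nocode \<notin> B"
  shows "emeasure M' (ext_code M e \<iota> -` B \<inter> space M') = emeasure (code_distr M e) B"
proof -
  have "e -` B \<inter> space M \<in> sets M" using e B by (intro measurable_sets)
  then have "emeasure M' (\<iota> ` (e -` B \<inter> space M)) = emeasure M (e -` B \<inter> space M)"
    using te by (auto simp: trivial_extension_def)
  then show ?thesis
    using e B ext_code_vimage[OF te B(2), of e] by (simp add: code_distr_def emeasure_distr)
qed

lemma coded_kernel_ext_code:
  assumes c: "coding M e d" and te: "trivial_extension M W \<iota> M' W'"
    and y: "y \<in> space M'" "y' \<in> space M'"
  shows "coded_kernel W d (ext_code M e \<iota> y) (ext_code M e \<iota> y') = W' y y'"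
proof (cases "y \<in> \<iota> ` space M \<and> y' \<in> \<iota> ` space M")
  case True
  then obtain x x' where "x \<in> space M" "x' \<in> space M" "y = \<iota> x" "y' = \<iota> x'" by auto
  then show ?thesis using c te
    by (simp add: ext_code_image[OF te] coded_kernel_def pullback_def coding_def trivial_extension_def)
next
  case False
  then have "ext_code M e \<iota> y = nocode \<or> ext_code M e \<iota> y' = nocode"
    by (auto simp: ext_code_def)
  moreover have "d nocode = Inr 0" using c by (simp add: coding_def)
  ultimately have "coded_kernel W d (ext_code M e \<iota> y) (ext_code M e \<iota> y') = 0"
    by (auto simp: coded_kernel_def pullback_def)
  moreover have "W' y y' = 0" using te y False by (auto simp: trivial_extension_def)
  ultimately show ?thesis by simp
qed

lemma integrable_pullback:
  assumes N: "sigma_finite_measure N" and M: "sigma_finite_measure M"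
    and mp: "measure_preserving N M \<phi>" and W: "integrable (M \<Otimes>\<^sub>M M) (\<lambda>z. W (fst z) (snd z))"
  shows "integrable (N \<Otimes>\<^sub>M N) (\<lambda>z. pullback \<phi> W (fst z) (snd z))"
proof -
  have \<phi>: "\<phi> \<in> measurable N M" using mp by (simp add: measure_preserving_def)
  have "push N (space N) M \<phi> = M"
    using mp \<phi> by (intro measure_eqI) (auto simp: push_space emeasure_distr measure_preserving_def)
  then have "set_integrable (N \<Otimes>\<^sub>M N) (space N \<times> space N) (\<lambda>z. pullback \<phi> W (fst z) (snd z))"
    using integrable_pair_push[OF N sets.top sets.top \<phi>, of "\<lambda>z. W (fst z) (snd z)"] M W
    by (simp add: pullback_def)
  then show ?thesis
    unfolding set_integrable_def
    by (subst (asm) Bochner_Integration.integrable_cong[OF refl, where g="\<lambda>z. pullback \<phi> W (fst z) (snd z)"])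
      (auto simp: space_pair_measure)
qed

lemma measurable_fst_snd_code [measurable]:
  "fst \<in> measurable (borel :: (code \<times> code) measure) borel"
  "snd \<in> measurable (borel :: (code \<times> code) measure) borel"
  by (auto simp: borel_prod[symmetric])

lemma measurable_code_diff:
  assumes "coding M1 e1 d1" "coding M2 e2 d2" "graphon M1 W1" "graphon M2 W2"
  shows "(\<lambda>z. code_diff (coded_kernel W1 d1) (coded_kernel W2 d2) (fst z) (snd z))
    \<in> borel_measurable (borel \<Otimes>\<^sub>M borel)"
proof -
  have "(\<lambda>z. coded_kernel W1 d1 (fst (fst z)) (fst (snd z))) \<in> borel_measurable ((borel :: (code \<times> code) measure) \<Otimes>\<^sub>M (borel :: (code \<times> code) measure))"
  proof -
    have "(\<lambda>z. (fst (fst z), fst (snd z))) \<in> measurable ((borel :: (code \<times> code) measure) \<Otimes>\<^sub>M (borel :: (code \<times> code) measure)) (borel \<Otimes>\<^sub>M borel)"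
      by (intro measurable_Pair measurable_compose[OF measurable_fst measurable_fst_snd_code(1)]
          measurable_compose[OF measurable_snd measurable_fst_snd_code(1)])
    from measurable_compose[OF this measurable_coded_kernel[OF assms(1,3)]] show ?thesis by simp
  qed
  moreover have "(\<lambda>z. coded_kernel W2 d2 (snd (fst z)) (snd (snd z))) \<in> borel_measurable ((borel :: (code \<times> code) measure) \<Otimes>\<^sub>M (borel :: (code \<times> code) measure))"
  proof -
    have "(\<lambda>z. (snd (fst z), snd (snd z))) \<in> measurable ((borel :: (code \<times> code) measure) \<Otimes>\<^sub>M (borel :: (code \<times> code) measure)) (borel \<Otimes>\<^sub>M borel)"
      by (intro measurable_Pair measurable_compose[OF measurable_fst measurable_fst_snd_code(2)]
          measurable_compose[OF measurable_snd measurable_fst_snd_code(2)])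
    from measurable_compose[OF this measurable_coded_kernel[OF assms(2,4)]] show ?thesis by simp
  qed
  ultimately show ?thesis unfolding code_diff_def by simp
qed

text \<open>The lower-bound half of the argument: whatever the extensions and their carrier types,
  the coupling has a coded coupling below it. The pair of codes \<open>h\<close> carries it there,
  and \<open>coded_kernel_ext_code\<close> shows that the coded kernels pull back to
  \<open>W1'\<close> and \<open>W2'\<close>, so that \<open>cut_norm_push_le\<close>
  applies.\<close>

lemma ex_coded_coupling_of_coupling:
  assumes c: "coding M1 e1 d1" "coding M2 e2 d2" and W: "graphon M1 W1" "graphon M2 W2"
    and te: "trivial_extension M1 W1 \<iota>1 M1' W1'" "trivial_extension M2 W2 \<iota>2 M2' W2'"
    and N: "coupling N M1' M2' \<phi>1 \<phi>2"
  shows "\<exists>s. coded_coupling (code_distr M1 e1) (code_distr M2 e2) s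
    \<and> cut_norm s (code_diff (coded_kernel W1 d1) (coded_kernel W2 d2))
      \<le> cut_norm N (\<lambda>x y. pullback \<phi>1 W1' x y - pullback \<phi>2 W2' x y)"
proof -
  have sf: "sigma_finite_measure N" and mp: "measure_preserving N M1' \<phi>1" "measure_preserving N M2' \<phi>2"
    using N by (auto simp: coupling_def)
  have \<phi>: "\<phi>1 \<in> measurable N M1'" "\<phi>2 \<in> measurable N M2'" using mp by (auto simp: measure_preserving_def)
  have e: "e1 \<in> measurable M1 borel" "e2 \<in> measurable M2 borel" using c by (auto simp: coding_def)
  define x1 x2 where "x1 = (\<lambda>y. ext_code M1 e1 \<iota>1 (\<phi>1 y))" and "x2 = (\<lambda>y. ext_code M2 e2 \<iota>2 (\<phi>2 y))"
  define h where "h y = (x1 y, x2 y)" for y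
  have x: "x1 \<in> measurable N borel" "x2 \<in> measurable N borel"
    unfolding x1_def x2_def
    using measurable_compose[OF \<phi>(1) measurable_ext_code[OF te(1) e(1)]]
      measurable_compose[OF \<phi>(2) measurable_ext_code[OF te(2) e(2)]] by auto
  have h: "h \<in> measurable N borel" unfolding h_def borel_prod[symmetric] using x by simp
  \<comment> \<open>Outside \<open>D\<close> lie the points that both maps send to added points.
    They would all collapse onto the zero pair, possibly with infinite mass, and both kernels vanish
    on them.\<close>
  define D where "D = h -` (- {(nocode, nocode)}) \<inter> space N"
  have D: "D \<in> sets N" unfolding D_def using nocode_borel by (intro measurable_sets[OF h]) auto
  define s where "s = push N D borel h"
  have m0: "emeasure (code_distr M1 e1) {nocode} = 0" "emeasure (code_distr M2 e2) {nocode} = 0"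
    using code_measure_code_distr[OF c(1)] code_measure_code_distr[OF c(2)] by (auto simp: code_measure_def)
  have marg: "push s (- p -` {nocode}) borel p = code_distr M e"
    if p: "p \<in> measurable borel borel" and te: "trivial_extension M W \<iota> M' W'" and \<phi>: "measure_preserving N M' \<phi>"
      and e: "e \<in> measurable M borel" and eq: "\<And>y. p (h y) = ext_code M e \<iota> (\<phi> y)"
      and m0: "emeasure (code_distr M e) {nocode} = 0" and pz: "p (nocode, nocode) = nocode"
    for p :: "code \<times> code \<Rightarrow> code" and M :: "'i measure" and W and M' :: "'j measure" and W' \<phi> \<iota> e
  proof (rule measure_eqI)
    show "sets (push s (- p -` {nocode}) borel p) = sets (code_distr M e)" by (simp add: code_distr_def)
    fix A assume "A \<in> sets (push s (- p -` {nocode}) borel p)"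
    then have A: "A \<in> sets borel" by simp
    have pv: "- p -` {nocode} \<in> sets borel"
      using measurable_sets[OF p, of "- {nocode}"] by (auto simp: vimage_Compl)
    have ps: "p \<in> measurable s borel" using p by (simp add: s_def cong: measurable_cong_sets)
    have "emeasure (push s (- p -` {nocode}) borel p) A = emeasure s (- p -` {nocode} \<inter> p -` A)"
      using pv ps A by (intro emeasure_push) (auto simp: s_def)
    also have "\<dots> = emeasure N (D \<inter> h -` (- p -` {nocode} \<inter> p -` A))"
      unfolding s_def using pv measurable_sets[OF p A] by (intro emeasure_push D h) auto
    also have "D \<inter> h -` (- p -` {nocode} \<inter> p -` A) = \<phi> -` (ext_code M e \<iota> -` (A - {nocode}) \<inter> space M') \<inter> space N"
    proof -
      have "\<phi> y \<in> space M'" if "y \<in> space N" for y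
        using \<phi> that by (auto simp: measure_preserving_def dest: measurable_space)
      moreover have "p (h y) \<noteq> nocode \<Longrightarrow> h y \<noteq> (nocode, nocode)" for y using pz by auto
      ultimately show ?thesis by (auto simp: D_def eq[symmetric])
    qed
    also have "emeasure N \<dots> = emeasure M' (ext_code M e \<iota> -` (A - {nocode}) \<inter> space M')"
    proof -
      have "ext_code M e \<iota> -` (A - {nocode}) \<inter> space M' \<in> sets M'"
        using A by (intro measurable_sets[OF measurable_ext_code[OF te e]]) auto
      then show ?thesis using \<phi> by (auto simp: measure_preserving_def)
    qed
    also have "\<dots> = emeasure (code_distr M e) (A - {nocode})"
      using A by (intro emeasure_ext_code[OF te e]) auto
    also have "\<dots> = emeasure (code_distr M e) A"
      using A m0 by (intro emeasure_Diff_null_set) (auto simp: null_sets_def code_distr_def)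
    finally show "emeasure (push s (- p -` {nocode}) borel p) A = emeasure (code_distr M e) A" .
  qed
  have "emeasure s {(nocode, nocode)} = emeasure N (D \<inter> h -` {(nocode, nocode)})"
    unfolding s_def by (intro emeasure_push D h nocode_borel)
  also have "D \<inter> h -` {(nocode, nocode)} = {}" by (auto simp: D_def)
  finally have cc: "coded_coupling (code_distr M1 e1) (code_distr M2 e2) s"
    unfolding coded_coupling_def
    using marg[OF measurable_fst_snd_code(1) te(1) mp(1) e(1) _ m0(1)]
      marg[OF measurable_fst_snd_code(2) te(2) mp(2) e(2) _ m0(2)]
    by (simp add: h_def x1_def x2_def) (simp add: s_def)
  have "cut_norm s (code_diff (coded_kernel W1 d1) (coded_kernel W2 d2))
      \<le> cut_norm N (\<lambda>x y. pullback \<phi>1 W1' x y - pullback \<phi>2 W2' x y)"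
    unfolding s_def
  proof (rule cut_norm_push_le[OF sf D h])
    show "sigma_finite_measure (push N D borel h)"
      using coded_coupling_sigma_finite[OF code_measure_code_distr[OF c(1)] code_measure_code_distr[OF c(2)] cc]
      by (simp add: s_def)
    show "(\<lambda>z. code_diff (coded_kernel W1 d1) (coded_kernel W2 d2) (fst z) (snd z)) \<in> borel_measurable (borel \<Otimes>\<^sub>M borel)"
      by (rule measurable_code_diff[OF c W])
    show "integrable (N \<Otimes>\<^sub>M N) (\<lambda>z. pullback \<phi>1 W1' (fst z) (snd z) - pullback \<phi>2 W2' (fst z) (snd z))"
      using te mp by (intro Bochner_Integration.integrable_diff integrable_pullback[OF sf])
        (auto simp: trivial_extension_def graphon_def)
    fix x y assume xy: "x \<in> space N" "y \<in> space N"
    show "pullback \<phi>1 W1' x y - pullback \<phi>2 W2' x y = code_diff (coded_kernel W1 d1) (coded_kernel W2 d2) (h x) (h y)"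
      using measurable_space[OF \<phi>(1)] measurable_space[OF \<phi>(2)] xy
      by (simp add: code_diff_def h_def x1_def x2_def pullback_def
          coded_kernel_ext_code[OF c(1) te(1)] coded_kernel_ext_code[OF c(2) te(2)])
  qed
  then show ?thesis using cc by blast
qed

section \<open>Decoding: from coded couplings to special couplings\<close>

text \<open>A point without code in the first coordinate is sent to a new point labelled by the first
  set of the cover that its other code belongs to, so that the new part is \<open>\<sigma>\<close>-finite as well.\<close>

definition decode :: "'a measure \<Rightarrow> (code \<Rightarrow> 'a + real) \<Rightarrow> code \<Rightarrow> code \<Rightarrow> 'a + real" where
  "decode M d c c' = (if d c \<in> Inl ` space M then d c else Inr (real (LEAST i. c' i)))"

lemma coded_coupling_coding_facts:
  assumes c: "coding M1 e1 d1" "coding M2 e2 d2"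
    and s: "coded_coupling (code_distr M1 e1) (code_distr M2 e2) \<sigma>"
  shows "sets \<sigma> = sets borel" "sigma_finite_measure \<sigma>"
  using coded_coupling_sigma_finite[OF c[THEN code_measure_code_distr] s] s
  by (auto simp: coded_coupling_def)

text \<open>A code that does not decode into \<open>M\<close> has \<open>d\<close>-value
  \<open>Inr 0\<close>. Relabelling it as another \<open>Inr\<close> point is invisible to the
  kernel, which is zero at all of them.\<close>

lemma ext_kernel_decode:
  assumes "coding M e d"
  shows "ext_kernel W (decode M d c b) (decode M d c' b') = coded_kernel W d c c'"
proof -
  have "d k \<in> Inl ` space M \<or> d k = Inr 0" for k using assms unfolding coding_def by blast
  then show ?thesis by (auto simp: decode_def coded_kernel_def pullback_def split: if_splits) force+
qed

lemma measurable_decode: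
  fixes p q :: "code \<times> code \<Rightarrow> code"
  assumes c: "coding M e d" and pq: "p \<in> measurable \<sigma> borel" "q \<in> measurable \<sigma> borel"
  shows "(\<lambda>x. decode M d (p x) (q x)) \<in> measurable \<sigma> (ext_space M)"
  unfolding decode_def
proof (rule measurable_If)
  have d: "d \<in> measurable borel (ext_space M)" using c by (simp add: coding_def)
  show dp: "(\<lambda>x. d (p x)) \<in> measurable \<sigma> (ext_space M)" by (rule measurable_compose[OF pq(1) d])
  have "Inl ` space M \<in> sets (ext_space M)" by auto
  then have "(\<lambda>x. d (p x)) -` Inl ` space M \<inter> space \<sigma> \<in> sets \<sigma>" by (rule measurable_sets[OF dp])
  moreover have "(\<lambda>x. d (p x)) -` Inl ` space M \<inter> space \<sigma> = {x \<in> space \<sigma>. d (p x) \<in> Inl ` space M}" by auto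
  ultimately show "{x \<in> space \<sigma>. d (p x) \<in> Inl ` space M} \<in> sets \<sigma>" by simp
  have "Measurable.pred \<sigma> (\<lambda>x. q x i)" for i
    by (rule measurable_compose[OF pq(2) pred_code])
  then have "(\<lambda>x. LEAST i. q x i) \<in> measurable \<sigma> (count_space UNIV)"
    by (rule measurable_Least)
  moreover have "(\<lambda>n :: nat. Inr (real n)) \<in> measurable (count_space UNIV) (ext_space M)"
    by (auto simp: space_ext_space)
  ultimately show "(\<lambda>x. Inr (real (LEAST i. q x i))) \<in> measurable \<sigma> (ext_space M)"
    by (rule measurable_compose)
qed

text \<open>Stated for abstract \<open>p\<close> and \<open>q\<close> so that it serves both spaces
  with the two projections exchanged. The copy of \<open>M\<close> gets the right measure from
  \<open>d (e x) = Inl x\<close>; the point to settle is that each new atom has finite mass, which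
  makes the extension \<sigma>-finite.\<close>

lemma trivial_extension_decode:
  fixes p q :: "code \<times> code \<Rightarrow> code"
  assumes c: "coding M e d" and W: "graphon M W"
    and \<sigma>: "sets \<sigma> = sets borel" "sigma_finite_measure \<sigma>"
    and pq: "p \<in> measurable \<sigma> borel" "q \<in> measurable \<sigma> borel"
    and p: "\<And>A. A \<in> sets borel \<Longrightarrow> emeasure (code_distr M e) A = emeasure \<sigma> (p -` (A - {nocode}))"
    and q: "\<And>i. emeasure \<sigma> (q -` {c. c i}) < \<infinity>"
    and null: "emeasure \<sigma> {x. p x = nocode \<and> q x = nocode} = 0"
    and int: "integrable (\<sigma> \<Otimes>\<^sub>M \<sigma>) (\<lambda>z. coded_kernel W d (p (fst z)) (p (snd z)))"
  defines "\<psi> \<equiv> \<lambda>x. decode M d (p x) (q x)"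
  defines "M' \<equiv> distr \<sigma> (ext_space M) \<psi>"
  shows "trivial_extension M W Inl M' (ext_kernel W)"
proof -
  have sp: "space \<sigma> = UNIV" using sets_eq_imp_space_eq[OF \<sigma>(1)] by simp
  have d: "d \<in> measurable borel (ext_space M)" and d0: "d nocode = Inr 0"
    and e: "e \<in> measurable M borel" and de: "\<And>x. x \<in> space M \<Longrightarrow> d (e x) = Inl x"
    and efin: "\<And>i. emeasure M {x\<in>space M. e x i} < \<infinity>"
    and ene: "\<And>x. x \<in> space M \<Longrightarrow> e x \<noteq> nocode"
    using c by (auto simp: coding_def)
  have \<psi>: "\<psi> \<in> measurable \<sigma> (ext_space M)" unfolding \<psi>_def by (rule measurable_decode[OF c pq])
  have dv: "d -` A \<in> sets borel" if "A \<in> sets (ext_space M)" for A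
    using measurable_sets[OF d that] by simp
  \<comment> \<open>A code that decodes to \<open>x\<close> need not be \<open>e x\<close>. This is
    harmless: off \<open>nocode\<close> the distribution of \<open>p\<close> is the image of
    \<open>M\<close> under \<open>e\<close>, so only the composition of \<open>d\<close> with
    \<open>e\<close> counts.\<close>
  have pd: "emeasure \<sigma> (p -` (d -` A - {nocode})) = emeasure M (e -` d -` A \<inter> space M)"
    if "A \<in> sets (ext_space M)" for A
    using p[OF dv[OF that]] dv[OF that] e by (simp add: code_distr_def emeasure_distr)
  have sM': "sets M' = sets (ext_space M)" "space M' = space (ext_space M)" by (simp_all add: M'_def)
  have Inl: "emeasure M' (Inl ` A) = emeasure M A" if A: "A \<in> sets M" for A
  proof -
    have A': "Inl ` A \<in> sets (ext_space M)" "A \<subseteq> space M" using A sets.sets_into_space by auto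
    have "emeasure M' (Inl ` A) = emeasure \<sigma> (\<psi> -` Inl ` A)"
      unfolding M'_def using A' \<psi> by (simp add: emeasure_distr sp)
    also have "\<psi> -` Inl ` A = p -` (d -` Inl ` A - {nocode})"
      using A'(2) d0 by (auto simp: \<psi>_def decode_def split: if_splits)
    also have "emeasure \<sigma> \<dots> = emeasure M (e -` d -` Inl ` A \<inter> space M)" by (rule pd[OF A'(1)])
    also have "e -` d -` Inl ` A \<inter> space M = A" using A'(2) de by auto
    finally show ?thesis .
  qed
  have Inr: "emeasure M' {Inr (real n)} < \<infinity>" for n
  proof -
    let ?E = "Inr ` \<nat> :: ('a + real) set"
    let ?A = "p -` (d -` ?E - {nocode})" and ?B = "q -` {c. c n}" and ?C = "{x. p x = nocode \<and> q x = nocode}"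
    have E: "?E \<in> sets (ext_space M)" "{Inr (real n)} \<in> sets (ext_space M)"
      using Inr_in_ext_space[of "{real n}" M] by auto
    have A: "?A \<in> sets \<sigma>" using measurable_sets[OF pq(1), of "d -` ?E - {nocode}"] dv[OF E(1)] by (simp add: sp)
    have B: "?B \<in> sets \<sigma>"
      using measurable_sets[OF pq(2), of "{c. c n}"] clopen_coord[of n] by (simp add: sp clopen_def)
    have C: "?C \<in> sets \<sigma>"
    proof -
      have "p -` {nocode} \<inter> space \<sigma> \<inter> (q -` {nocode} \<inter> space \<sigma>) \<in> sets \<sigma>"
        by (intro sets.Int measurable_sets[OF pq(1)] measurable_sets[OF pq(2)] nocode_borel)
      moreover have "p -` {nocode} \<inter> space \<sigma> \<inter> (q -` {nocode} \<inter> space \<sigma>) = ?C" by (auto simp: sp)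
      ultimately show ?thesis by simp
    qed
    \<comment> \<open>Three ways to land on this atom: a code other than \<open>nocode\<close> that
      decodes to no point, which is null by \<open>pd\<close>; a true coordinate \<open>n\<close> in
      the other code, of finite mass by \<open>q\<close>; the zero pair, which is null.\<close>
    have "\<psi> -` {Inr (real n)} \<subseteq> ?A \<union> ?B \<union> ?C"
    proof
      fix x assume x: "x \<in> \<psi> -` {Inr (real n)}"
      then have dp: "d (p x) \<notin> Inl ` space M" and n: "(LEAST i. q x i) = n"
        by (auto simp: \<psi>_def decode_def split: if_splits)
      have "d (p x) \<in> space (ext_space M)" using measurable_space[OF d] by simp
      with dp have "d (p x) \<in> ?E" by (auto simp: space_ext_space)
      moreover have "q x n" if "q x \<noteq> nocode"
      proof -
        from that obtain i where "q x i" by (auto simp: fun_eq_iff)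
        then show ?thesis using n LeastI[of "q x" i] by simp
      qed
      ultimately show "x \<in> ?A \<union> ?B \<union> ?C" by auto
    qed
    then have "emeasure \<sigma> (\<psi> -` {Inr (real n)}) \<le> emeasure \<sigma> (?A \<union> ?B \<union> ?C)"
      using A B C by (intro emeasure_mono sets.Un)
    also have "\<dots> \<le> emeasure \<sigma> (?A \<union> ?B) + emeasure \<sigma> ?C"
      using A B C by (intro emeasure_subadditive sets.Un)
    also have "\<dots> \<le> emeasure \<sigma> ?A + emeasure \<sigma> ?B + emeasure \<sigma> ?C"
      using A B by (intro add_right_mono emeasure_subadditive)
    also have "emeasure \<sigma> ?A = 0"
    proof -
      have "e -` d -` ?E \<inter> space M = {}" using de by auto
      then show ?thesis unfolding pd[OF E(1)] by simp
    qed
    also have "0 + emeasure \<sigma> ?B + emeasure \<sigma> ?C < \<infinity>" using q null by simp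
    finally show ?thesis unfolding M'_def using \<psi> E(2) by (simp add: emeasure_distr sp)
  qed
  have sf: "sigma_finite_measure M'"
  proof
    let ?C = "range (\<lambda>i. Inl ` {x\<in>space M. e x i}) \<union> range (\<lambda>n. {Inr (real n)}) :: ('a + real) set set"
    have S: "{x\<in>space M. e x i} \<in> sets M" for i
      using measurable_compose[OF e pred_code[of i]] by (simp add: pred_def)
    have "Inl ` {x\<in>space M. e x i} \<in> sets M'" "{Inr (real n)} \<in> sets M'" for i n
      using S Inr_in_ext_space[of "{real n}" M] by (auto simp: sM')
    then have "?C \<subseteq> sets M'" by auto
    moreover have "\<Union>?C = space M'"
    proof -
      have "\<exists>i. e x i" if "x \<in> space M" for x using ene[OF that] by (auto simp: fun_eq_iff)
      then show ?thesis by (auto simp: sM' space_ext_space Nats_def image_iff)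
    qed
    moreover have "\<forall>a\<in>?C. emeasure M' a \<noteq> \<infinity>"
      using Inl[OF S] efin Inr by (auto simp: less_top)
    ultimately show "\<exists>A. countable A \<and> A \<subseteq> sets M' \<and> \<Union>A = space M' \<and> (\<forall>a\<in>A. emeasure M' a \<noteq> \<infinity>)"
      by (intro exI[of _ ?C]) auto
  qed
  have push: "push \<sigma> UNIV (ext_space M) \<psi> = M'"
    using push_space[OF \<psi>] by (simp add: M'_def sp)
  have Wm: "(\<lambda>z. ext_kernel W (fst z) (snd z)) \<in> borel_measurable (ext_space M \<Otimes>\<^sub>M ext_space M)"
    using W by (intro measurable_ext_kernel) (auto simp: graphon_def)
  have "UNIV \<in> sets \<sigma>" using sets.top[of \<sigma>] by (simp add: sp)
  then have "integrable (M' \<Otimes>\<^sub>M M') (\<lambda>z. ext_kernel W (fst z) (snd z))"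
    using integrable_pair_push[OF \<sigma>(2) _ _ \<psi> _ Wm, of UNIV UNIV, unfolded push] int sf
    by (simp add: set_integrable_def \<psi>_def ext_kernel_decode[OF c])
  moreover have "ext_kernel W y y' = ext_kernel W y' y" if "y \<in> space M'" "y' \<in> space M'" for y y'
    using that W by (auto simp: sM' space_ext_space graphon_def)
  ultimately have "graphon M' (ext_kernel W)"
    using sf by (simp add: graphon_def)
  then show ?thesis
    unfolding trivial_extension_def
    using Inl measurable_Inl_ext_space[of M]
    by (auto simp: sM' space_ext_space inj_on_def cong: measurable_cong_sets)
qed

text \<open>Both extended measures are images of the single measure \<open>\<sigma>\<close>, so
  their total masses agree automatically, and \<open>N\<close> is its image under the pair of
  decoding maps. One inequality between the cut norms suffices, as optimality of
  \<open>\<sigma>\<close> supplies the lower bound.\<close>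

lemma decoded_coupling:
  assumes c: "coding M1 e1 d1" "coding M2 e2 d2" and W: "graphon M1 W1" "graphon M2 W2"
    and s: "coded_coupling (code_distr M1 e1) (code_distr M2 e2) \<sigma>"
  obtains M1' M2' N where
    "trivial_extension M1 W1 Inl M1' (ext_kernel W1)" "trivial_extension M2 W2 Inl M2' (ext_kernel W2)"
    "emeasure M1' (space M1') = emeasure M2' (space M2')" "special_coupling N M1' M2'"
    "cut_norm N (\<lambda>x y. pullback fst (ext_kernel W1) x y - pullback snd (ext_kernel W2) x y)
      \<le> cut_norm \<sigma> (code_diff (coded_kernel W1 d1) (coded_kernel W2 d2))"
proof -
  note m = c[THEN code_measure_code_distr]
  note k = code_kernel_coded_kernel[OF c(1) W(1)] code_kernel_coded_kernel[OF c(2) W(2)]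
  note \<sigma> = coded_coupling_coding_facts[OF c s]
  note int = coded_coupling_kernels_integrable[OF m s k]
  have sp: "space \<sigma> = UNIV" using sets_eq_imp_space_eq[OF \<sigma>(1)] by simp
  have ms: "fst \<in> measurable \<sigma> borel" "snd \<in> measurable \<sigma> borel"
    using measurable_fst_snd_code \<sigma>(1) by (auto cong: measurable_cong_sets)
  have b: "{c :: code. c i} \<in> sets borel" for i using clopen_coord[of i] by (auto simp: clopen_def)
  have d: "{c :: code. c i} - {nocode} = {c. c i}" for i by auto
  have fin: "emeasure \<sigma> (fst -` {c. c i}) < \<infinity>" "emeasure \<sigma> (snd -` {c. c i}) < \<infinity>" for i
  proof -
    have "emeasure (code_distr M1 e1) {c. c i} < \<infinity>" "emeasure (code_distr M2 e2) {c. c i} < \<infinity>"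
      using m by (auto simp: code_measure_def)
    then show "emeasure \<sigma> (fst -` {c. c i}) < \<infinity>" "emeasure \<sigma> (snd -` {c. c i}) < \<infinity>"
      unfolding coded_coupling_emeasure[OF s b[of i]] d .
  qed
  have null: "emeasure \<sigma> {x. fst x = nocode \<and> snd x = nocode} = 0"
    "emeasure \<sigma> {x. snd x = nocode \<and> fst x = nocode} = 0"
  proof -
    have "{x. fst x = nocode \<and> snd x = nocode} = {(nocode, nocode)}"
      "{x. snd x = nocode \<and> fst x = nocode} = {(nocode, nocode)}" by auto
    then show "emeasure \<sigma> {x. fst x = nocode \<and> snd x = nocode} = 0"
      "emeasure \<sigma> {x. snd x = nocode \<and> fst x = nocode} = 0"
      using s by (simp_all add: coded_coupling_def)
  qed
  define \<psi>1 where "\<psi>1 x = decode M1 d1 (fst x) (snd x)" for x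
  define \<psi>2 where "\<psi>2 x = decode M2 d2 (snd x) (fst x)" for x
  define M1' M2' where "M1' = distr \<sigma> (ext_space M1) \<psi>1" and "M2' = distr \<sigma> (ext_space M2) \<psi>2"
  define h where "h x = (\<psi>1 x, \<psi>2 x)" for x
  define N where "N = distr \<sigma> (ext_space M1 \<Otimes>\<^sub>M ext_space M2) h"
  have \<psi>: "\<psi>1 \<in> measurable \<sigma> (ext_space M1)" "\<psi>2 \<in> measurable \<sigma> (ext_space M2)"
    unfolding \<psi>1_def \<psi>2_def by (rule measurable_decode[OF c(1) ms] measurable_decode[OF c(2) ms(2,1)])+
  have h: "h \<in> measurable \<sigma> (ext_space M1 \<Otimes>\<^sub>M ext_space M2)"
    unfolding h_def using \<psi> by simp
  have te: "trivial_extension M1 W1 Inl M1' (ext_kernel W1)" "trivial_extension M2 W2 Inl M2' (ext_kernel W2)"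
    unfolding M1'_def M2'_def \<psi>1_def \<psi>2_def
    using trivial_extension_decode[OF c(1) W(1) \<sigma> ms coded_coupling_emeasure(1)[OF s] fin(2) null(1) int(1)]
      trivial_extension_decode[OF c(2) W(2) \<sigma> ms(2) ms(1) coded_coupling_emeasure(2)[OF s] fin(1) null(2) int(2)]
    by blast+
  have total: "emeasure M1' (space M1') = emeasure \<sigma> UNIV" "emeasure M2' (space M2') = emeasure \<sigma> UNIV"
    using emeasure_distr[OF \<psi>(1) sets.top] emeasure_distr[OF \<psi>(2) sets.top]
      measurable_space[OF \<psi>(1)] measurable_space[OF \<psi>(2)]
    by (auto simp: M1'_def M2'_def sp vimage_def)
  have dN: "distr N (ext_space M1) fst = M1'" "distr N (ext_space M2) snd = M2'"
    unfolding N_def M1'_def M2'_def using h by (simp_all add: distr_distr comp_def h_def)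
  have sN: "sets N = sets (M1' \<Otimes>\<^sub>M M2')"
    by (simp add: N_def M1'_def M2'_def cong: sets_pair_measure_cong)
  have fN: "fst \<in> measurable N (ext_space M1)" "snd \<in> measurable N (ext_space M2)" by (simp_all add: N_def)
  \<comment> \<open>Preimages of a cover of the first marginal by sets of finite measure cover
    \<open>N\<close>.\<close>
  have sfN: "sigma_finite_measure N"
    by (rule sigma_finite_measure_distr[OF _ fN(1)])
      (use te(1) in \<open>simp add: dN trivial_extension_def graphon_def\<close>)
  have mp: "measure_preserving N M1' fst" "measure_preserving N M2' snd"
    unfolding measure_preserving_def
    using fN emeasure_distr[OF fN(1)] emeasure_distr[OF fN(2)]
    by (auto simp: dN) (auto simp: M1'_def M2'_def cong: measurable_cong_sets)
  have sc: "special_coupling N M1' M2'"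
    using sN sfN mp by (simp add: special_coupling_def coupling_def)
  have push: "push \<sigma> UNIV (ext_space M1 \<Otimes>\<^sub>M ext_space M2) h = N"
    using push_space[OF h] by (simp add: N_def sp)
  have "cut_norm (push \<sigma> UNIV (ext_space M1 \<Otimes>\<^sub>M ext_space M2) h)
      (\<lambda>x y. pullback fst (ext_kernel W1) x y - pullback snd (ext_kernel W2) x y)
      \<le> cut_norm \<sigma> (code_diff (coded_kernel W1 d1) (coded_kernel W2 d2))"
  proof (rule cut_norm_push_le[OF \<sigma>(2) _ h])
    show "UNIV \<in> sets \<sigma>" using sets.top[of \<sigma>] by (simp add: sp)
    show "sigma_finite_measure (push \<sigma> UNIV (ext_space M1 \<Otimes>\<^sub>M ext_space M2) h)" unfolding push by (rule sfN)
    let ?E = "ext_space M1 \<Otimes>\<^sub>M ext_space M2"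
    have "(\<lambda>z. (fst (fst z), fst (snd z))) \<in> measurable (?E \<Otimes>\<^sub>M ?E) (ext_space M1 \<Otimes>\<^sub>M ext_space M1)"
      "(\<lambda>z. (snd (fst z), snd (snd z))) \<in> measurable (?E \<Otimes>\<^sub>M ?E) (ext_space M2 \<Otimes>\<^sub>M ext_space M2)"
      by measurable
    from measurable_compose[OF this(1) measurable_ext_kernel[of W1]]
      measurable_compose[OF this(2) measurable_ext_kernel[of W2]] W
    show "(\<lambda>z. pullback fst (ext_kernel W1) (fst z) (snd z) - pullback snd (ext_kernel W2) (fst z) (snd z))
      \<in> borel_measurable (?E \<Otimes>\<^sub>M ?E)"
      by (auto simp: pullback_def graphon_def)
    show "integrable (\<sigma> \<Otimes>\<^sub>M \<sigma>) (\<lambda>z. code_diff (coded_kernel W1 d1) (coded_kernel W2 d2) (fst z) (snd z))"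
      by (rule int(3))
    show "code_diff (coded_kernel W1 d1) (coded_kernel W2 d2) x y
      = pullback fst (ext_kernel W1) (h x) (h y) - pullback snd (ext_kernel W2) (h x) (h y)" for x y
      by (simp add: code_diff_def pullback_def h_def \<psi>1_def \<psi>2_def ext_kernel_decode[OF c(1)] ext_kernel_decode[OF c(2)])
  qed
  then show ?thesis using that te total sc unfolding push by simp
qed

section \<open>Attainment of the cut distance\<close>

text \<open>The two spaces are placed side by side: each point is matched with an added point of the
  other space, by \<open>i1\<close> and \<open>i2\<close>. This makes the set of values to be
  minimized nonempty even when the total masses differ.\<close>

lemma disjoint_coded_coupling:
  assumes m: "code_measure m1" "code_measure m2"
  obtains s where "coded_coupling m1 m2 s"
proof -
  define i1 i2 :: "code \<Rightarrow> code \<times> code" where "i1 = (\<lambda>k. (k, nocode))" and "i2 = (\<lambda>k. (nocode, k))"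
  have sm: "sets m1 = sets borel" "sets m2 = sets borel" using m by (auto simp: code_measure_def)
  have sp: "space m1 = UNIV" "space m2 = UNIV"
    using sets_eq_imp_space_eq[OF sm(1)] sets_eq_imp_space_eq[OF sm(2)] by auto
  have i: "i1 \<in> measurable m1 borel" "i2 \<in> measurable m2 borel"
    unfolding i1_def i2_def borel_prod[symmetric] using sm by (auto cong: measurable_cong_sets)
  define f where "f B = emeasure m1 (i1 -` B) + emeasure m2 (i2 -` B)" for B
  have iv: "i1 -` B \<in> sets m1" "i2 -` B \<in> sets m2" if "B \<in> sets borel" for B
    using measurable_sets[OF i(1) that] measurable_sets[OF i(2) that] by (auto simp: sp)
  define s where "s = measure_of UNIV (sets (borel :: (code \<times> code) measure)) f"
  have ss: "sets s = sets borel"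
    using sets.sigma_sets_eq[of "borel :: (code \<times> code) measure"] by (simp add: s_def)
  have es: "emeasure s B = f B" if "B \<in> sets borel" for B
    unfolding s_def
  proof (rule emeasure_measure_of_sigma)
    show "sigma_algebra UNIV (sets (borel :: (code \<times> code) measure))"
      using sets.sigma_algebra_axioms[of "borel :: (code \<times> code) measure"] by simp
    show "positive (sets borel) f" by (simp add: positive_def f_def)
    show "countably_additive (sets borel) f"
    proof (rule countably_additiveI)
      fix A :: "nat \<Rightarrow> (code \<times> code) set"
      assume A: "range A \<subseteq> sets borel" "disjoint_family A"
      have "(\<Sum>k. emeasure m1 (i1 -` A k)) = emeasure m1 (\<Union>k. i1 -` A k)"
        using A iv by (intro suminf_emeasure) (auto simp: disjoint_family_on_def, blast)
      moreover have "(\<Sum>k. emeasure m2 (i2 -` A k)) = emeasure m2 (\<Union>k. i2 -` A k)"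
        using A iv by (intro suminf_emeasure) (auto simp: disjoint_family_on_def, blast)
      ultimately show "(\<Sum>k. f (A k)) = f (\<Union>k. A k)"
        by (simp add: f_def suminf_add[symmetric] vimage_UN)
    qed
  qed (rule that)
  have off: "emeasure m (A - {nocode}) = emeasure m A" if "code_measure m" "A \<in> sets borel" for m A
    using that by (intro emeasure_Diff_null_set) (auto simp: null_sets_def code_measure_def)
  have marg: "push s (- p -` {nocode}) borel p = m"
    if p: "p \<in> measurable borel borel" and m: "code_measure m"
      and f: "\<And>A. A \<in> sets borel \<Longrightarrow> f (- p -` {nocode} \<inter> p -` A) = emeasure m (A - {nocode})"
    for p :: "code \<times> code \<Rightarrow> code" and m
  proof (rule measure_eqI)
    show "sets (push s (- p -` {nocode}) borel p) = sets m" using m by (simp add: code_measure_def)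
    fix A assume "A \<in> sets (push s (- p -` {nocode}) borel p)"
    then have A: "A \<in> sets borel" by simp
    have pv: "- p -` {nocode} \<in> sets borel"
      using measurable_sets[OF p, of "- {nocode}"] by (auto simp: vimage_Compl)
    have "emeasure (push s (- p -` {nocode}) borel p) A = emeasure s (- p -` {nocode} \<inter> p -` A)"
      using pv p A by (intro emeasure_push) (auto simp: ss cong: measurable_cong_sets)
    also have "\<dots> = emeasure m (A - {nocode})"
      using pv measurable_sets[OF p A] by (subst es) (auto simp: f[OF A])
    finally show "emeasure (push s (- p -` {nocode}) borel p) A = emeasure m A"
      using off[OF m A] by simp
  qed
  have "f (- fst -` {nocode} \<inter> fst -` A) = emeasure m1 (A - {nocode})" for A
  proof -
    have "i1 -` (- fst -` {nocode} \<inter> fst -` A) = A - {nocode}" "i2 -` (- fst -` {nocode} \<inter> fst -` A) = {}"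
      by (auto simp: i1_def i2_def)
    then show ?thesis by (simp add: f_def)
  qed
  moreover have "f (- snd -` {nocode} \<inter> snd -` A) = emeasure m2 (A - {nocode})" for A
  proof -
    have "i1 -` (- snd -` {nocode} \<inter> snd -` A) = {}" "i2 -` (- snd -` {nocode} \<inter> snd -` A) = A - {nocode}"
      by (auto simp: i1_def i2_def)
    then show ?thesis by (simp add: f_def)
  qed
  moreover have "f {(nocode, nocode)} = 0"
  proof -
    have "i1 -` {(nocode, nocode)} = {nocode}" "i2 -` {(nocode, nocode)} = {nocode}"
      by (auto simp: i1_def i2_def)
    then show ?thesis using m by (simp add: f_def code_measure_def)
  qed
  ultimately have "coded_coupling m1 m2 s"
    unfolding coded_coupling_def
    using ss es[OF nocode_borel(2)] marg[OF measurable_fst_snd_code(1) m(1)] marg[OF measurable_fst_snd_code(2) m(2)]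
    by auto
  then show ?thesis by (rule that)
qed

lemma trivial_extension_refl:
  assumes "graphon M W" shows "trivial_extension M W (\<lambda>x. x) M W"
  using assms by (auto simp: trivial_extension_def)

text \<open>The distance between the extended graphons ranges over extensions of extensions. By
  transitivity these extend the original graphons, so the lower bound found for the originals covers
  them.\<close>

lemma trivial_extension_trans:
  assumes 1: "trivial_extension M W \<iota> M' W'" and 2: "trivial_extension M' W' \<kappa> M'' W''"
  shows "trivial_extension M W (\<kappa> \<circ> \<iota>) M'' W''"
proof -
  have sub: "\<iota> ` space M \<subseteq> space M'"
    using 1 sets.sets_into_space by (auto simp: trivial_extension_def)
  have \<kappa>\<iota>: "(\<kappa> \<circ> \<iota>) ` A = \<kappa> ` (\<iota> ` A)" for A by auto
  have "W'' y z = 0" if yz: "y \<in> space M''" "z \<in> space M''"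
    "\<not> (y \<in> \<kappa> ` \<iota> ` space M \<and> z \<in> \<kappa> ` \<iota> ` space M)" for y z
  proof (cases "y \<in> \<kappa> ` space M' \<and> z \<in> \<kappa> ` space M'")
    case True
    then obtain y' z' where yz': "y' \<in> space M'" "z' \<in> space M'" "y = \<kappa> y'" "z = \<kappa> z'" by auto
    then have "\<not> (y' \<in> \<iota> ` space M \<and> z' \<in> \<iota> ` space M)" using yz(3) by auto
    then have "W' y' z' = 0" using 1 yz' by (auto simp: trivial_extension_def)
    then show ?thesis using 2 yz' by (auto simp: trivial_extension_def)
  next
    case False
    then show ?thesis using 2 yz by (auto simp: trivial_extension_def)
  qed
  moreover have "inj_on (\<kappa> \<circ> \<iota>) (space M)"
    using 1 2 sub by (intro comp_inj_on) (auto simp: trivial_extension_def intro: inj_on_subset)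
  moreover have "\<kappa> \<circ> \<iota> \<in> measurable M M''"
    using 1 2 by (intro measurable_comp) (auto simp: trivial_extension_def)
  moreover have "(\<kappa> \<circ> \<iota>) ` A \<in> sets M'' \<and> emeasure M'' ((\<kappa> \<circ> \<iota>) ` A) = emeasure M A" if "A \<in> sets M" for A
    unfolding \<kappa>\<iota> using 1 2 that unfolding trivial_extension_def by metis
  moreover have "W'' (\<kappa> (\<iota> x)) (\<kappa> (\<iota> y)) = W x y" if "x \<in> space M" "y \<in> space M" for x y
  proof -
    have "\<iota> x \<in> space M'" "\<iota> y \<in> space M'" using sub that by auto
    then show ?thesis using 1 2 that unfolding trivial_extension_def by metis
  qed
  ultimately show ?thesis
    using 2 unfolding trivial_extension_def by (auto simp: image_comp)
qed

lemma cut_dist_greatest: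
  fixes c :: ereal
  assumes "\<And>(M1' :: 'c measure) W1' \<iota>1 (M2' :: 'd measure) W2' \<iota>2 (N :: 'e measure) \<phi>1 \<phi>2.
      trivial_extension M1 W1 \<iota>1 M1' W1' \<Longrightarrow> trivial_extension M2 W2 \<iota>2 M2' W2' \<Longrightarrow>
      coupling N M1' M2' \<phi>1 \<phi>2 \<Longrightarrow> c \<le> ereal (cut_norm N (\<lambda>x y. pullback \<phi>1 W1' x y - pullback \<phi>2 W2' x y))"
  shows "c \<le> cut_dist TYPE('c) TYPE('d) TYPE('e) M1 W1 M2 W2"
  unfolding cut_dist_def by (rule INF_greatest) (use assms in auto)

lemma cut_dist_le:
  fixes M1' :: "'c measure" and M2' :: "'d measure" and N :: "'e measure"
  assumes "trivial_extension M1 W1 \<iota>1 M1' W1'" "trivial_extension M2 W2 \<iota>2 M2' W2'"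
    "emeasure M1' (space M1') = emeasure M2' (space M2')" "coupling N M1' M2' \<phi>1 \<phi>2"
  shows "cut_dist TYPE('c) TYPE('d) TYPE('e) M1 W1 M2 W2
    \<le> ereal (cut_norm N (\<lambda>x y. pullback \<phi>1 W1' x y - pullback \<phi>2 W2' x y))"
  unfolding cut_dist_def by (rule INF_lower) (use assms in blast)

text \<open>The types \<open>'c\<close>, \<open>'d\<close> and \<open>'e\<close> are free, so the
  last two inequalities say that no choice of carrier types yields a smaller value; together with
  the two equations they express that the infimum over all types is attained by
  \<open>N\<close>.\<close>

theorem theoremT1:
  fixes M1 :: "'a measure" and W1 :: "'a \<Rightarrow> 'a \<Rightarrow> real"
    and M2 :: "'b measure" and W2 :: "'b \<Rightarrow> 'b \<Rightarrow> real"
  assumes "graphon M1 W1" and "graphon M2 W2"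
    and "borel_msp TYPE('p::polish_space) M1" and "borel_msp TYPE('q::polish_space) M2"
  shows "\<exists>(M1' :: ('a + real) measure) W1' \<iota>1 (M2' :: ('b + real) measure) W2' \<iota>2
            (N :: (('a + real) \<times> ('b + real)) measure).
     trivial_extension M1 W1 \<iota>1 M1' W1' \<and> trivial_extension M2 W2 \<iota>2 M2' W2'
     \<and> emeasure M1' (space M1') = emeasure M2' (space M2')
     \<and> special_coupling N M1' M2'
     \<and> (let c = ereal (cut_norm N (\<lambda>x y. pullback fst W1' x y - pullback snd W2' x y)) in
          cut_dist TYPE('a + real) TYPE('b + real) TYPE(('a + real) \<times> ('b + real)) M1 W1 M2 W2 = c
        \<and> cut_dist TYPE('a + real) TYPE('b + real) TYPE(('a + real) \<times> ('b + real)) M1' W1' M2' W2' = c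
        \<and> c \<le> cut_dist TYPE('c) TYPE('d) TYPE('e) M1 W1 M2 W2
        \<and> c \<le> cut_dist TYPE('c) TYPE('d) TYPE('e) M1' W1' M2' W2')"
proof -
  note W = assms(1,2)
  obtain e1 d1 where c1: "coding M1 e1 d1"
    using ex_coding[OF assms(3)] W(1) by (auto simp: graphon_def)
  obtain e2 d2 where c2: "coding M2 e2 d2"
    using ex_coding[OF assms(4)] W(2) by (auto simp: graphon_def)
  note m = code_measure_code_distr[OF c1] code_measure_code_distr[OF c2]
  let ?F = "code_diff (coded_kernel W1 d1) (coded_kernel W2 d2)"
  obtain s0 where "coded_coupling (code_distr M1 e1) (code_distr M2 e2) s0"
    by (rule disjoint_coded_coupling[OF m])
  from optimal_coded_coupling[OF m code_kernel_coded_kernel[OF c1 W(1)] code_kernel_coded_kernel[OF c2 W(2)] this]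
  obtain \<sigma> where \<sigma>: "coded_coupling (code_distr M1 e1) (code_distr M2 e2) \<sigma>"
    and opt: "\<And>s. coded_coupling (code_distr M1 e1) (code_distr M2 e2) s \<Longrightarrow> cut_norm \<sigma> ?F \<le> cut_norm s ?F"
    by blast
  obtain M1' M2' N where te: "trivial_extension M1 W1 Inl M1' (ext_kernel W1)"
      "trivial_extension M2 W2 Inl M2' (ext_kernel W2)"
    and total: "emeasure M1' (space M1') = emeasure M2' (space M2')" and N: "special_coupling N M1' M2'"
    and cut_N: "cut_norm N (\<lambda>x y. pullback fst (ext_kernel W1) x y - pullback snd (ext_kernel W2) x y)
      \<le> cut_norm \<sigma> ?F"
    by (rule decoded_coupling[OF c1 c2 W \<sigma>])
  define c where "c = ereal (cut_norm N (\<lambda>x y. pullback fst (ext_kernel W1) x y - pullback snd (ext_kernel W2) x y))"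
  have cN: "coupling N M1' M2' fst snd" using N by (simp add: special_coupling_def)
  \<comment> \<open>The fact is generalized over the carrier types \<open>'x\<close>,
    \<open>'y\<close>, \<open>'z\<close>, so that it applies both to the sum types of the witness
    and to the free types.\<close>
  have le: "c \<le> ereal (cut_norm N' (\<lambda>x y. pullback \<phi>1 V1 x y - pullback \<phi>2 V2 x y))"
    if "trivial_extension M1 W1 \<iota>1 L1 V1" "trivial_extension M2 W2 \<iota>2 L2 V2" "coupling N' L1 L2 \<phi>1 \<phi>2"
    for L1 :: "'x measure" and V1 \<iota>1 and L2 :: "'y measure" and V2 \<iota>2 and N' :: "'z measure" and \<phi>1 \<phi>2
    using ex_coded_coupling_of_coupling[OF c1 c2 W that] opt cut_N by (force simp: c_def)
  have le': "c \<le> ereal (cut_norm N' (\<lambda>x y. pullback \<phi>1 V1 x y - pullback \<phi>2 V2 x y))"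
    if "trivial_extension M1' (ext_kernel W1) \<iota>1 L1 V1" "trivial_extension M2' (ext_kernel W2) \<iota>2 L2 V2" "coupling N' L1 L2 \<phi>1 \<phi>2"
    for L1 :: "'x measure" and V1 \<iota>1 and L2 :: "'y measure" and V2 \<iota>2 and N' :: "'z measure" and \<phi>1 \<phi>2
    using trivial_extension_trans[OF te(1) that(1)] trivial_extension_trans[OF te(2) that(2)] that(3) by (rule le)
  \<comment> \<open>Regarded as extensions of themselves, \<open>M1'\<close> and \<open>M2'\<close>
    with the coupling \<open>N\<close> already realize the value \<open>c\<close>, which gives the
    upper bound for their own distance.\<close>
  have refl: "trivial_extension M1' (ext_kernel W1) (\<lambda>x. x) M1' (ext_kernel W1)"
    "trivial_extension M2' (ext_kernel W2) (\<lambda>x. x) M2' (ext_kernel W2)"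
    using te by (auto intro!: trivial_extension_refl simp: trivial_extension_def)
  have "cut_dist TYPE('a + real) TYPE('b + real) TYPE(('a + real) \<times> ('b + real)) M1 W1 M2 W2 = c"
  proof (rule antisym)
    show "cut_dist TYPE('a + real) TYPE('b + real) TYPE(('a + real) \<times> ('b + real)) M1 W1 M2 W2 \<le> c"
      unfolding c_def by (rule cut_dist_le[OF te total cN])
    show "c \<le> cut_dist TYPE('a + real) TYPE('b + real) TYPE(('a + real) \<times> ('b + real)) M1 W1 M2 W2"
      by (rule cut_dist_greatest) (rule le)
  qed
  moreover have "cut_dist TYPE('a + real) TYPE('b + real) TYPE(('a + real) \<times> ('b + real))
      M1' (ext_kernel W1) M2' (ext_kernel W2) = c"
  proof (rule antisym)
    show "cut_dist TYPE('a + real) TYPE('b + real) TYPE(('a + real) \<times> ('b + real))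
      M1' (ext_kernel W1) M2' (ext_kernel W2) \<le> c"
      unfolding c_def by (rule cut_dist_le[OF refl total cN])
    show "c \<le> cut_dist TYPE('a + real) TYPE('b + real) TYPE(('a + real) \<times> ('b + real))
      M1' (ext_kernel W1) M2' (ext_kernel W2)"
      by (rule cut_dist_greatest) (rule le')
  qed
  moreover have "c \<le> cut_dist TYPE('c) TYPE('d) TYPE('e) M1 W1 M2 W2"
    by (rule cut_dist_greatest) (rule le)
  moreover have "c \<le> cut_dist TYPE('c) TYPE('d) TYPE('e) M1' (ext_kernel W1) M2' (ext_kernel W2)"
    by (rule cut_dist_greatest) (rule le')
  ultimately show ?thesis
    using te total N unfolding Let_def c_def by blast
qed

end
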